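(* Let $A$, $B$, $B'$ and $\mathbb{X}$ be positive stable matrices in $\mathbb{C}^{r\times r}$, with $A\mathbb{X}=\mathbb{X}A$, $AB=BA$ and $AB'=B'A$, and let $\lambda,\mu\in\mathbb{C}$ be such that $\Re(\mu)>\Re(\lambda)>0$. Then, for $|t|<\frac{1}{1+|z|}$, $$\sum_{n=0}^{\infty}\frac{(B')_{n}}{n!}\,F^{(\mathbb{X})}(B-nI,A;A+(\mu-\lambda)I;z)\,t^{n}=(1-t)^{-B'}\,F_{1}\Big(A,B,B';A+(\mu-\lambda)I;z,\frac{-zt}{1-t};\mathbb{X}\Big).$$
   Context: $\mathbb{C}^{r\times r}$ is the space of complex $r\times r$ matrices and $I$ is the identity; $z,t$ are complex variables. A matrix is positive stable if all its eigenvalues have positive real part. Matrix powers are $t^{M}=\exp(M\log t)$; in particular $(1-s)^{-M}=\sum_{n\ge0}(M)_n\frac{s^n}{n!}$ for $|s|<1$. For positive stable $M$, $\Gamma(M)=\int_0^\infty e^{-t}t^{M-I}dt$, and $\Gamma^{-1}(M)$ is its inverse. The Pochhammer symbol is $(M)_0=I$, $(M)_n=M(M+I)\cdots(M+(n-1)I)$ for $n\ge1$. Extended beta matrix function: for commuting positive stable matrices $P,Q,\mathbb{X}$, $$\mathfrak{B}(P,Q;\mathbb{X})=\int_0^1 t^{P-I}(1-t)^{Q-I}\exp\Big(\frac{-\mathbb{X}}{t(1-t)}\Big)dt.$$ Extended Gauss hypergeometric matrix function: for positive stable $P,Q,R,R-Q,\mathbb{X}$ with $Q,R,\mathbb{X}$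 commuting with each other, $$F^{(\mathbb{X})}(P,Q;R;z)=\left(\sum_{m\ge0}(P)_m\,\mathfrak{B}(Q+mI,R-Q;\mathbb{X})\frac{z^m}{m!}\right)\Gamma(R)\Gamma^{-1}(Q)\Gamma^{-1}(R-Q);$$ $F^{(\mathbb{X})}(B-nI,A;A+(\mu-\lambda)I;z)$ denotes this same expression with $P=B-nI$, $Q=A$, $R=A+(\mu-\lambda)I$. Extended Appell matrix function $F_1$: for positive stable $A,B,B',C,C-A,\mathbb{X}$ with $A,C,\mathbb{X}$ commuting with each other and $CB=BC$, $CB'=B'C$, $$F_{1}(A,B,B';C;z,w;\mathbb{X})=\Gamma(C)\Gamma^{-1}(A)\Gamma^{-1}(C-A)\sum_{m,n\ge0}\mathfrak{B}(A+(m+n)I,C-A;\mathbb{X})\,(B)_m(B')_n\frac{z^mw^n}{m!\,n!}.$$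
   Formalization: It is further assumed that $B\mathbb{X}=\mathbb{X}B$, $B'\mathbb{X}=\mathbb{X}B'$ and $BB'=B'B$, without which the identity fails in general, and that $|z|\le1$, since the series defining $F^{(\mathbb{X})}$ diverges for $|z|>1$. *)

theory Defs
  imports "HOL-Analysis.Analysis"
begin

text \<open>
  Complex \<open>r \<times> r\<close> matrices are rendered as \<open>complex^'r^'r\<close> with \<open>r = CARD('r)\<close>.  The matrix
  product is \<open>**\<close>; plain \<open>*\<close> is componentwise on this type, so the library's \<open>^\<close> and \<open>exp\<close>
  cannot be used for matrix powers and the matrix exponential.  Also, \<open>mat c\<close> is the scalar matrix \<open>c I\<close>.
\<close>

type_synonym 'r cmat = "complex^'r^'r"

definition cscale :: "complex \<Rightarrow> 'r::finite cmat \<Rightarrow> 'r cmat" (infixr "*\<^sub>m" 75) where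
  "c *\<^sub>m M = (\<chi> i j. c * M $ i $ j)"

definition eigenvalue :: "'r::finite cmat \<Rightarrow> complex \<Rightarrow> bool" where
  "eigenvalue M c \<longleftrightarrow> (\<exists>v. v \<noteq> 0 \<and> M *v v = c *s v)"

definition positive_stable :: "'r::finite cmat \<Rightarrow> bool" where
  "positive_stable M \<longleftrightarrow> (\<forall>c. eigenvalue M c \<longrightarrow> Re c > 0)"

primrec mpow :: "'r::finite cmat \<Rightarrow> nat \<Rightarrow> 'r cmat" where
  "mpow M 0 = mat 1"
| "mpow M (Suc n) = M ** mpow M n"

definition mexp :: "'r::finite cmat \<Rightarrow> 'r cmat" where
  "mexp M = (\<Sum>n. (1 / fact n) *\<^sub>m mpow M n)"

text \<open>\<open>t\<^sup>M = exp (M log t)\<close>, with the principal branch of the logarithm.\<close>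

definition mpowr :: "complex \<Rightarrow> 'r::finite cmat \<Rightarrow> 'r cmat" where
  "mpowr t M = mexp (Ln t *\<^sub>m M)"

primrec mpochhammer :: "'r::finite cmat \<Rightarrow> nat \<Rightarrow> 'r cmat" where
  "mpochhammer M 0 = mat 1"
| "mpochhammer M (Suc n) = mpochhammer M n ** (M + mat (of_nat n))"

definition mGamma :: "'r::finite cmat \<Rightarrow> 'r cmat" where
  "mGamma M = (LINT t:{0<..}|lborel. of_real (exp (- t)) *\<^sub>m mpowr (of_real t) (M - mat 1))"

definition ext_beta :: "'r::finite cmat \<Rightarrow> 'r cmat \<Rightarrow> 'r cmat \<Rightarrow> 'r cmat" where
  "ext_beta P Q X =
     (LINT t:{0<..<1}|lborel.
        mpowr (of_real t) (P - mat 1) ** mpowr (of_real (1 - t)) (Q - mat 1)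
          ** mexp (of_real (- 1 / (t * (1 - t))) *\<^sub>m X))"

text \<open>
  The factors do not commute in general, so their order below matters: the Gamma factors are on
  the right in \<open>ext_gauss\<close> and on the left in \<open>ext_appell1\<close>, and likewise for the position of the
  beta function relative to the Pochhammer symbols.
\<close>

definition ext_gauss ::
  "'r::finite cmat \<Rightarrow> 'r cmat \<Rightarrow> 'r cmat \<Rightarrow> 'r cmat \<Rightarrow> complex \<Rightarrow> 'r cmat" where
  "ext_gauss X P Q R z =
     (\<Sum>m. (z ^ m / fact m) *\<^sub>m
        (mpochhammer P m ** ext_beta (Q + mat (of_nat m)) (R - Q) X))
     ** mGamma R ** matrix_inv (mGamma Q) ** matrix_inv (mGamma (R - Q))"

definition ext_appell1 ::
  "'r::finite cmat \<Rightarrow> 'r cmat \<Rightarrow> 'r cmat \<Rightarrow> 'r cmat \<Rightarrow> complex \<Rightarrow> complex \<Rightarrow> 'r cmat \<Rightarrow> 'r cmat"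
where
  "ext_appell1 A B B' C z w X =
     mGamma C ** matrix_inv (mGamma A) ** matrix_inv (mGamma (C - A))
     ** (\<Sum>\<^sub>\<infinity>(m, n)\<in>UNIV. (z ^ m * w ^ n / (fact m * fact n)) *\<^sub>m
          (ext_beta (A + mat (of_nat (m + n))) (C - A) X
             ** mpochhammer B m ** mpochhammer B' n))"

end

theory Submission
  imports Defs "HOL-Combinatorics.Stirling" "HOL-Computational_Algebra.Fundamental_Theorem_Algebra"
begin

text \<open>
  Write \<open>\<beta>\<^sub>k\<close> for the beta function at \<open>A + k I\<close>.  All matrices involved commute, so only the
  coefficient of \<open>\<beta>\<^sub>k z\<^sup>k\<close> matters.  By the Vandermonde convolution
  \<open>(B - n)\<^sub>k = \<Sum>\<^sub>j (k choose j) (-n)\<^sub>j (B)\<^bsub>k-j\<^esub>\<close>, summing over \<open>n\<close> on the left reduces to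
  \<open>\<Sum>\<^sub>n (B')\<^sub>n (-n)\<^sub>j t\<^sup>n / n! = (- t / (1 - t))\<^sup>j (B')\<^sub>j (1 - t)\<^bsup>-B'\<^esup>\<close>, which is the binomial
  theorem for \<open>B' + j I\<close>.  The interchange is legitimate because \<open>\<beta>\<^sub>k\<close> decays faster than every
  power of \<open>k\<close>.  The Gamma factors can be moved across once \<open>\<Gamma>(A)\<close> is known to be invertible
  (the junk value of \<open>matrix_inv\<close> need not commute with anything): its kernel is \<open>A\<close>-invariant,
  while on an eigenvector \<open>\<Gamma>(A)\<close> acts as the nonzero number \<open>\<Gamma>(c)\<close>.
\<close>

subsection \<open>Matrix arithmetic and norms\<close>

lemma cscale_nth [simp]: "(c *\<^sub>m M) $ i $ j = c * M $ i $ j"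
  by (simp add: cscale_def)

lemma cmat_eqI:
  fixes M N :: "'r::finite cmat"
  assumes "\<And>i j. M $ i $ j = N $ i $ j"
  shows "M = N"
  using assms by (simp add: vec_eq_iff)

lemma matrix_mul_nth: "(M ** N) $ i $ j = (\<Sum>k\<in>UNIV. M $ i $ k * N $ k $ j)"
  by (simp add: matrix_matrix_mult_def)

lemma norm_cmat_power2:
  fixes M :: "'r::finite cmat"
  shows "norm M ^ 2 = (\<Sum>i\<in>UNIV. \<Sum>j\<in>UNIV. norm (M $ i $ j) ^ 2)"
  by (simp add: norm_vec_def L2_set_def sum_nonneg)

lemma norm_cmat_nth_le: "norm ((M :: 'r::finite cmat) $ i $ j) \<le> norm M"
  using Finite_Cartesian_Product.norm_nth_le[where x = M and i = i]
    Finite_Cartesian_Product.norm_nth_le[where x = "M $ i" and i = j]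
  by linarith

lemma norm_cscale: "norm (c *\<^sub>m M) = norm c * norm (M :: 'r::finite cmat)"
proof (rule power2_eq_imp_eq)
  show "norm (c *\<^sub>m M) ^ 2 = (norm c * norm M) ^ 2"
    unfolding power_mult_distrib norm_cmat_power2
    by (simp add: norm_mult power_mult_distrib sum_distrib_left)
qed auto

lemma norm_matrix_mul_le:
  fixes M N :: "'r::finite cmat"
  shows "norm (M ** N) \<le> norm M * norm N"
proof (rule power2_le_imp_le)
  have *: "norm ((M ** N) $ i $ j) ^ 2
      \<le> (\<Sum>k\<in>UNIV. norm (M $ i $ k) ^ 2) * (\<Sum>k\<in>UNIV. norm (N $ k $ j) ^ 2)" for i j
  proof -
    have "norm ((M ** N) $ i $ j) \<le> (\<Sum>k\<in>UNIV. \<bar>norm (M $ i $ k)\<bar> * \<bar>norm (N $ k $ j)\<bar>)"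
      unfolding matrix_mul_nth by (rule order_trans[OF norm_sum]) (simp add: norm_mult)
    also have "\<dots> \<le> L2_set (\<lambda>k. norm (M $ i $ k)) UNIV * L2_set (\<lambda>k. norm (N $ k $ j)) UNIV"
      by (rule L2_set_mult_ineq)
    finally have "norm ((M ** N) $ i $ j) ^ 2
        \<le> (L2_set (\<lambda>k. norm (M $ i $ k)) UNIV * L2_set (\<lambda>k. norm (N $ k $ j)) UNIV) ^ 2"
      by (simp add: power_mono)
    then show ?thesis
      by (simp add: power_mult_distrib L2_set_def sum_nonneg)
  qed
  have "norm (M ** N) ^ 2 \<le> (\<Sum>i\<in>UNIV. \<Sum>j\<in>UNIV.
      (\<Sum>k\<in>UNIV. norm (M $ i $ k) ^ 2) * (\<Sum>k\<in>UNIV. norm (N $ k $ j) ^ 2))"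
    unfolding norm_cmat_power2 by (intro sum_mono *)
  also have "\<dots> = norm M ^ 2 * norm N ^ 2"
    unfolding norm_cmat_power2 sum_product [symmetric]
    by (simp add: sum.swap [of "\<lambda>i k. norm (N $ i $ k) ^ 2"])
  finally show "norm (M ** N) ^ 2 \<le> (norm M * norm N) ^ 2"
    by (simp add: power_mult_distrib)
qed auto

lemma cscale_cscale [simp]: "a *\<^sub>m b *\<^sub>m M = (a * b) *\<^sub>m M"
  by (intro cmat_eqI) simp

lemma cscale_zero_left [simp]: "0 *\<^sub>m M = 0"
  by (intro cmat_eqI) simp

lemma cscale_zero_right [simp]: "c *\<^sub>m 0 = 0"
  by (intro cmat_eqI) simp

lemma cscale_one [simp]: "1 *\<^sub>m M = M"
  by (intro cmat_eqI) simp

lemma scaleR_eq_cscale: "x *\<^sub>R M = complex_of_real x *\<^sub>m M"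
  by (intro cmat_eqI) (simp add: scaleR_conv_of_real[where 'a = complex])

lemma cscale_add_left: "(a + b) *\<^sub>m M = a *\<^sub>m M + b *\<^sub>m M"
  by (intro cmat_eqI) (simp add: algebra_simps)

lemma cscale_add_right: "c *\<^sub>m (M + N) = c *\<^sub>m M + c *\<^sub>m N"
  by (intro cmat_eqI) (simp add: algebra_simps)

lemma cscale_minus_left: "(- c) *\<^sub>m M = c *\<^sub>m (- M)"
  by (intro cmat_eqI) simp

lemma cscale_mat: "c *\<^sub>m mat d = mat (c * d)"
  by (intro cmat_eqI) (simp add: mat_def)

lemma cscale_sum_right: "c *\<^sub>m sum f S = (\<Sum>i\<in>S. c *\<^sub>m f i)"
  by (induction S rule: infinite_finite_induct) (auto simp: cscale_add_right)

lemma mat_add: "mat (a + b) = mat a + (mat b :: 'r::finite cmat)"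
  by (intro cmat_eqI) (simp add: mat_def)

lemma cscale_mult_left [simp]:
  fixes M N :: "'r::finite cmat"
  shows "(c *\<^sub>m M) ** N = c *\<^sub>m (M ** N)"
  by (intro cmat_eqI) (simp add: matrix_mul_nth sum_distrib_left mult_ac)

lemma cscale_mult_right [simp]:
  fixes M N :: "'r::finite cmat"
  shows "M ** (c *\<^sub>m N) = c *\<^sub>m (M ** N)"
  by (intro cmat_eqI) (simp add: matrix_mul_nth sum_distrib_left mult_ac)

lemma matrix_add_rdistrib:
  fixes M N L :: "'r::finite cmat"
  shows "(M + N) ** L = M ** L + N ** L"
  by (intro cmat_eqI) (simp add: matrix_mul_nth sum.distrib algebra_simps)

lemma mat_eq_cscale: "mat c = c *\<^sub>m (mat 1 :: 'r::finite cmat)"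
  by (simp add: cscale_mat)

lemma mat_mult_left [simp]: "mat c ** M = c *\<^sub>m (M :: 'r::finite cmat)"
  by (subst mat_eq_cscale) simp

lemma mat_mult_right [simp]: "M ** mat c = c *\<^sub>m (M :: 'r::finite cmat)"
  by (subst mat_eq_cscale) simp

lemma cscale_mult_vec: "(c *\<^sub>m M) *v v = c *s (M *v v)"
  by (simp add: vec_eq_iff matrix_vector_mult_def sum_distrib_left mult_ac)

lemma mult_axis_nth: "((M :: 'r::finite cmat) *v axis j 1) $ i = M $ i $ j"
  by (simp add: matrix_vector_mult_def axis_def if_distrib cong: if_cong)

lemma bounded_linear_cscale: "bounded_linear ((*\<^sub>m) c :: 'r::finite cmat \<Rightarrow> 'r cmat)"
proof (rule bounded_linear_intro[where K = "norm c"])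
  show "c *\<^sub>m (r *\<^sub>R M) = r *\<^sub>R (c *\<^sub>m M)" for r and M :: "'r cmat"
    by (intro cmat_eqI) simp
qed (simp_all add: cscale_add_right norm_cscale)

lemma bounded_linear_cscale_left: "bounded_linear (\<lambda>c. c *\<^sub>m (M :: 'r::finite cmat))"
proof (rule bounded_linear_intro[where K = "norm M"])
  show "(r *\<^sub>R c) *\<^sub>m M = r *\<^sub>R (c *\<^sub>m M)" for r c
    by (intro cmat_eqI) simp
qed (simp_all add: cscale_add_left norm_cscale)

lemma bounded_linear_mul_left: "bounded_linear (\<lambda>M :: 'r::finite cmat. M ** (N :: 'r cmat))"
proof (rule bounded_linear_intro[where K = "norm N"])
  show "(r *\<^sub>R M) ** N = r *\<^sub>R (M ** N)" for r and M :: "'r cmat"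
    by (simp add: scalar_matrix_assoc)
qed (simp_all add: matrix_add_rdistrib norm_matrix_mul_le)

lemma bounded_linear_mul_right: "bounded_linear (\<lambda>M :: 'r::finite cmat. (N :: 'r cmat) ** M)"
proof (rule bounded_linear_intro[where K = "norm N"])
  show "N ** (r *\<^sub>R M) = r *\<^sub>R (N ** M)" for r and M :: "'r cmat"
    by (simp add: matrix_scalar_ac scalar_matrix_assoc)
  show "norm (N ** M) \<le> norm M * norm N" for M :: "'r cmat"
    using norm_matrix_mul_le[of N M] by (simp add: mult.commute)
qed (simp add: matrix_add_ldistrib)

lemma bounded_linear_cmat_nth: "bounded_linear (\<lambda>M :: 'r::finite cmat. M $ i $ j)"
  using bounded_linear_compose[OF bounded_linear_vec_nth bounded_linear_vec_nth] .

lemma matrix_mul_sum_left: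
  fixes f :: "'a \<Rightarrow> 'r::finite cmat" and M :: "'r cmat"
  shows "sum f S ** M = (\<Sum>i\<in>S. f i ** M)"
  by (rule linear_sum[OF bounded_linear.linear[OF bounded_linear_mul_left[of M]]])

lemma matrix_mul_sum_right:
  fixes f :: "'a \<Rightarrow> 'r::finite cmat" and M :: "'r cmat"
  shows "M ** sum f S = (\<Sum>i\<in>S. M ** f i)"
  by (rule linear_sum[OF bounded_linear.linear[OF bounded_linear_mul_right[of M]]])

lemma matrix_mul_diff_left:
  fixes M N L :: "'r::finite cmat"
  shows "(M - N) ** L = M ** L - N ** L"
  by (rule linear_diff[OF bounded_linear.linear[OF bounded_linear_mul_left]])

lemma matrix_mul_diff_right:
  fixes M N L :: "'r::finite cmat"
  shows "L ** (M - N) = L ** M - L ** N"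
  by (rule linear_diff[OF bounded_linear.linear[OF bounded_linear_mul_right]])

lemma matrix_mul_minus_left:
  fixes M L :: "'r::finite cmat"
  shows "(- M) ** L = - (M ** L)"
  by (rule linear_neg[OF bounded_linear.linear[OF bounded_linear_mul_left]])

lemma matrix_mul_minus_right:
  fixes M L :: "'r::finite cmat"
  shows "L ** (- M) = - (L ** M)"
  by (rule linear_neg[OF bounded_linear.linear[OF bounded_linear_mul_right]])

subsection \<open>The matrix exponential\<close>

lemma mpow_cscale: "mpow (c *\<^sub>m M) n = c ^ n *\<^sub>m mpow M n"
  by (induction n) (simp_all add: mult_ac)

lemma mpow_commute:
  assumes "N ** M = M ** (N :: 'r::finite cmat)"
  shows "N ** mpow M n = mpow M n ** N"
proof (induction n)
  case (Suc n)
  have "N ** mpow M (Suc n) = M ** (N ** mpow M n)"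
    by (simp add: matrix_mul_assoc assms)
  then show ?case
    by (simp add: Suc.IH matrix_mul_assoc)
qed simp

lemma norm_mpow_le: "norm (mpow M n) \<le> norm (mat 1 :: 'r::finite cmat) * norm (M :: 'r cmat) ^ n"
proof (induction n)
  case (Suc n)
  have "norm (mpow M (Suc n)) \<le> norm M * norm (mpow M n)"
    by (simp add: norm_matrix_mul_le)
  also have "\<dots> \<le> norm M * (norm (mat 1 :: 'r cmat) * norm M ^ n)"
    by (intro mult_left_mono Suc.IH) auto
  finally show ?case by (simp add: mult_ac)
qed simp

lemma summable_norm_mexp: "summable (\<lambda>n. norm ((1 / fact n) *\<^sub>m mpow (M :: 'r::finite cmat) n))"
proof (rule summable_comparison_test')
  show "summable (\<lambda>n. norm (mat 1 :: 'r cmat) * (inverse (fact n) * norm M ^ n))"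
    by (intro summable_mult summable_exp)
  show "norm (norm ((1 / fact n) *\<^sub>m mpow M n)) \<le> norm (mat 1 :: 'r cmat) * (inverse (fact n) * norm M ^ n)"
    if "n \<ge> 0" for n
    using norm_mpow_le[of M n] by (simp add: norm_cscale norm_divide divide_simps mult_ac)
qed

lemma mexp_sums: "(\<lambda>n. (1 / fact n) *\<^sub>m mpow M n) sums mexp (M :: 'r::finite cmat)"
  unfolding mexp_def by (rule summable_sums[OF summable_norm_cancel[OF summable_norm_mexp]])

lemma norm_mexp_le: "norm (mexp (M :: 'r::finite cmat)) \<le> norm (mat 1 :: 'r cmat) * exp (norm M)"
proof -
  have "norm (mexp M) \<le> (\<Sum>n. norm ((1 / fact n) *\<^sub>m mpow M n))"
    unfolding mexp_def by (rule summable_norm[OF summable_norm_mexp])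
  also have "\<dots> \<le> (\<Sum>n. norm (mat 1 :: 'r cmat) * (inverse (fact n) * norm M ^ n))"
  proof (rule suminf_le[OF _ summable_norm_mexp])
    show "summable (\<lambda>n. norm (mat 1 :: 'r cmat) * (inverse (fact n) * norm M ^ n))"
      by (intro summable_mult summable_exp)
    show "norm ((1 / fact n) *\<^sub>m mpow M n) \<le> norm (mat 1 :: 'r cmat) * (inverse (fact n) * norm M ^ n)" for n
      using norm_mpow_le[of M n] by (simp add: norm_cscale norm_divide divide_simps mult_ac)
  qed
  also have "\<dots> = norm (mat 1 :: 'r cmat) * exp (norm M)"
    by (subst suminf_mult[OF summable_exp]) (simp add: exp_def divide_inverse mult_ac)
  finally show ?thesis .
qed

lemma mexp_commute:
  assumes "N ** M = M ** (N :: 'r::finite cmat)"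
  shows "N ** mexp M = mexp M ** N"
proof (rule sums_unique2)
  show "(\<lambda>n. N ** ((1 / fact n) *\<^sub>m mpow M n)) sums (N ** mexp M)"
    by (rule bounded_linear.sums[OF bounded_linear_mul_right mexp_sums])
  show "(\<lambda>n. N ** ((1 / fact n) *\<^sub>m mpow M n)) sums (mexp M ** N)"
    using bounded_linear.sums[OF bounded_linear_mul_left mexp_sums, of M N]
    by (simp add: mpow_commute[OF assms])
qed

lemma mpow_add_mat:
  "mpow (M + mat c) n = (\<Sum>k\<le>n. (of_nat (n choose k) * c ^ (n - k)) *\<^sub>m mpow (M :: 'r::finite cmat) k)"
proof (induction n)
  case (Suc n)
  let ?f = "\<lambda>n k. (of_nat (n choose k) * c ^ (n - k)) *\<^sub>m mpow M k"
  have "mpow (M + mat c) (Suc n) = M ** (\<Sum>k\<le>n. ?f n k) + c *\<^sub>m (\<Sum>k\<le>n. ?f n k)"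
    by (simp only: mpow.simps Suc.IH matrix_add_rdistrib mat_mult_left)
  also have "M ** (\<Sum>k\<le>n. ?f n k) = (\<Sum>k\<le>n. M ** ?f n k)"
    by (rule matrix_mul_sum_right)
  also have "(\<Sum>k\<le>n. M ** ?f n k)
      = (\<Sum>k\<le>Suc n. if k = 0 then 0 else (of_nat (n choose (k - 1)) * c ^ (Suc n - k)) *\<^sub>m mpow M k)"
    by (simp add: sum.atMost_Suc_shift del: sum.atMost_Suc)
  also have "c *\<^sub>m (\<Sum>k\<le>n. ?f n k) = (\<Sum>k\<le>Suc n. (of_nat (n choose k) * c ^ (Suc n - k)) *\<^sub>m mpow M k)"
    by (simp add: cscale_sum_right Suc_diff_le binomial_eq_0 mult_ac)
  also have "(\<Sum>k\<le>Suc n. if k = 0 then 0 else (of_nat (n choose (k - 1)) * c ^ (Suc n - k)) *\<^sub>m mpow M k) + \<dots>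
     = (\<Sum>k\<le>Suc n. ?f (Suc n) k)"
    unfolding sum.distrib[symmetric]
  proof (rule sum.cong[OF refl])
    fix k assume "k \<in> {..Suc n}"
    show "(if k = 0 then 0 else (of_nat (n choose (k - 1)) * c ^ (Suc n - k)) *\<^sub>m mpow M k)
        + (of_nat (n choose k) * c ^ (Suc n - k)) *\<^sub>m mpow M k = ?f (Suc n) k"
      by (cases k) (simp_all add: algebra_simps flip: cscale_add_left)
  qed
  finally show ?case .
qed simp

lemma mexp_add_mat: "mexp (M + mat c) = exp c *\<^sub>m mexp (M :: 'r::finite cmat)"
proof (rule cmat_eqI)
  fix i j
  let ?a = "\<lambda>k. ((1 / fact k) *\<^sub>m mpow M k) $ i $ j" and ?b = "\<lambda>k. c ^ k /\<^sub>R fact k"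
  have "(\<lambda>k. \<Sum>l\<le>k. ?a l * ?b (k - l)) sums ((\<Sum>k. ?a k) * (\<Sum>k. ?b k))"
  proof (rule Cauchy_product_sums)
    show "summable (\<lambda>k. norm (?a k))"
      by (rule summable_comparison_test'[OF summable_norm_mexp[of M], of 0])
         (simp only: real_norm_def abs_norm_cancel norm_cmat_nth_le)
    show "summable (\<lambda>k. norm (?b k))"
      by (rule summable_norm_exp)
  qed
  moreover have "(\<Sum>k. ?a k) = mexp M $ i $ j"
    using bounded_linear.sums[OF bounded_linear_cmat_nth[of i j] mexp_sums[of M]] by (rule sums_unique[symmetric])
  moreover have "(\<Sum>k. ?b k) = exp c"
    by (simp add: exp_def)
  moreover have "(\<Sum>l\<le>k. ?a l * ?b (k - l)) = ((1 / fact k) *\<^sub>m mpow (M + mat c) k) $ i $ j" for k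
    unfolding mpow_add_mat cscale_sum_right
    by (auto simp: binomial_fact scaleR_conv_of_real field_simps intro!: sum.cong)
  ultimately have "(\<lambda>k. ((1 / fact k) *\<^sub>m mpow (M + mat c) k) $ i $ j) sums (mexp M $ i $ j * exp c)"
    by simp
  from sums_unique2[OF this bounded_linear.sums[OF bounded_linear_cmat_nth mexp_sums]]
  show "mexp (M + mat c) $ i $ j = (exp c *\<^sub>m mexp M) $ i $ j"
    by (simp add: mult.commute)
qed

lemma mexp_zero: "mexp 0 = (mat 1 :: 'r::finite cmat)"
proof (rule sums_unique2[OF mexp_sums])
  have *: "(1 / fact n) *\<^sub>m mpow (0 :: 'r cmat) n = (if n = 0 then mat 1 else 0)" for n
    by (cases n) simp_all
  show "(\<lambda>n. (1 / fact n) *\<^sub>m mpow (0 :: 'r cmat) n) sums mat 1"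
    unfolding * using sums_single[of 0 "\<lambda>_. mat 1 :: 'r cmat"] by simp
qed

lemma mpowr_commute:
  "N ** M = M ** (N :: 'r::finite cmat) \<Longrightarrow> N ** mpowr c M = mpowr c M ** N"
  unfolding mpowr_def by (rule mexp_commute) simp

lemma mpowr_add_mat: "c \<noteq> 0 \<Longrightarrow> mpowr c (M + mat d) = (c powr d) *\<^sub>m mpowr c (M :: 'r::finite cmat)"
  by (simp add: mpowr_def cscale_add_right cscale_mat mexp_add_mat powr_def mult.commute)

lemma bounded_linear_mul_vec_nth: "bounded_linear (\<lambda>M :: 'r::finite cmat. (M *v v) $ i)"
  unfolding matrix_vector_mult_def
  by (auto intro!: bounded_linear_sum bounded_linear_mult_const bounded_linear_cmat_nth)

lemma mexp_cscale_mult_vec_sums: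
  "(\<lambda>n. (mpow M n *v v) $ i / fact n * s ^ n) sums ((mexp (s *\<^sub>m (M :: 'r::finite cmat)) *v v) $ i)"
proof -
  have "((1 / fact n) *\<^sub>m mpow (s *\<^sub>m M) n *v v) $ i = (mpow M n *v v) $ i / fact n * s ^ n" for n
    by (simp add: mpow_cscale cscale_mult_vec)
  then show ?thesis
    using bounded_linear.sums[OF bounded_linear_mul_vec_nth[of v i] mexp_sums[of "s *\<^sub>m M"]] by simp
qed

lemma mexp_mult_vec_has_field_derivative:
  "((\<lambda>s. (mexp (s *\<^sub>m M) *v v) $ i) has_field_derivative (mexp (s *\<^sub>m (M :: 'r::finite cmat)) *v (M *v v)) $ i) (at s)"
proof -
  let ?c = "\<lambda>n. (mpow M n *v v) $ i / fact n"
  have "((\<lambda>s. \<Sum>n. ?c n * s ^ n) has_field_derivative (\<Sum>n. diffs ?c n * s ^ n)) (at s)"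
    by (rule termdiffs_strong_converges_everywhere) (rule sums_summable[OF mexp_cscale_mult_vec_sums])
  moreover have "(\<Sum>n. ?c n * s ^ n) = (mexp (s *\<^sub>m M) *v v) $ i" for s
    by (rule sums_unique[OF mexp_cscale_mult_vec_sums, symmetric])
  moreover have "diffs ?c n = (mpow M n *v (M *v v)) $ i / fact n" for n
    by (simp add: diffs_def matrix_vector_mul_assoc mpow_commute[symmetric] del: of_nat_Suc)
  ultimately show ?thesis
    by (simp only: sums_unique[OF mexp_cscale_mult_vec_sums, symmetric])
qed

subsection \<open>Polynomials in a matrix and eigenvalue induction\<close>

definition mpoly_eval :: "complex poly \<Rightarrow> 'r::finite cmat \<Rightarrow> 'r cmat" where
  "mpoly_eval p M = fold_coeffs (\<lambda>a N. mat a + M ** N) p 0"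

lemma mpoly_eval_0 [simp]: "mpoly_eval 0 M = 0"
  by (simp add: mpoly_eval_def)

lemma mpoly_eval_pCons [simp]: "mpoly_eval (pCons a p) M = mat a + M ** mpoly_eval p M"
  by (cases "p = 0 \<and> a = 0") (auto simp: mpoly_eval_def)

lemma mpoly_eval_add: "mpoly_eval (p + q) M = mpoly_eval p M + mpoly_eval q M"
  by (induction p q rule: poly_induct2) (simp_all add: mat_add matrix_add_ldistrib)

lemma mpoly_eval_smult: "mpoly_eval (smult c p) M = c *\<^sub>m mpoly_eval p M"
  by (induction p) (simp_all add: cscale_add_right cscale_mat)

lemma mpoly_eval_monom: "mpoly_eval (monom c n) M = c *\<^sub>m mpow M n"
  by (induction n) (simp_all add: monom_Suc monom_0 cscale_mat)

lemma mpoly_eval_sum: "mpoly_eval (sum f S) M = (\<Sum>i\<in>S. mpoly_eval (f i) M)"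
  by (induction S rule: infinite_finite_induct) (simp_all add: mpoly_eval_add)

lemma mpoly_eval_linear_mult:
  "mpoly_eval ([:- c, 1:] * p) M = (M - mat c) ** mpoly_eval p M"
proof -
  have "[:- c, 1:] * p = pCons 0 p + smult (- c) p"
    by simp
  then show ?thesis
    by (simp only: mpoly_eval_add mpoly_eval_smult mpoly_eval_pCons)
       (simp add: matrix_mul_diff_left, intro cmat_eqI, simp)
qed

lemma mpoly_eval_commute:
  assumes "N ** M = M ** N"
  shows "N ** mpoly_eval p M = mpoly_eval p M ** N"
proof (induction p)
  case (pCons a p)
  have "N ** (M ** mpoly_eval p M) = M ** (N ** mpoly_eval p M)"
    by (simp add: matrix_mul_assoc assms)
  then show ?case
    by (simp add: matrix_add_ldistrib matrix_add_rdistrib pCons.IH matrix_mul_assoc)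
qed simp

lemma exists_annihilating_poly: "\<exists>p. p \<noteq> 0 \<and> mpoly_eval p (M :: 'r::finite cmat) = 0"
proof (cases "inj (mpow M)")
  case True
  then have "infinite (range (mpow M))"
    using finite_imageD by blast
  then have "dependent (range (mpow M))"
    using independent_imp_finite by blast
  then obtain S u where S: "finite S" "S \<subseteq> range (mpow M)" "(\<Sum>N\<in>S. u N *\<^sub>R N) = 0" "\<exists>N\<in>S. u N \<noteq> 0"
    unfolding dependent_explicit by blast
  obtain T where T: "S = mpow M ` T" "inj_on (mpow M) T"
    using S(2) True by (metis inj_on_subset subset_imageE subset_UNIV)
  have fin: "finite T"
    using S(1) T finite_imageD by blast
  let ?p = "\<Sum>i\<in>T. monom (complex_of_real (u (mpow M i))) i"
  have "mpoly_eval ?p M = (\<Sum>i\<in>T. u (mpow M i) *\<^sub>R mpow M i)"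
    unfolding mpoly_eval_sum mpoly_eval_monom
    by (simp add: scaleR_eq_cscale)
  also have "\<dots> = 0"
    using S(3) T by (simp add: sum.reindex)
  finally have "mpoly_eval ?p M = 0" .
  moreover obtain i where i: "i \<in> T" "u (mpow M i) \<noteq> 0"
    using S(4) T by auto
  have "coeff ?p i = u (mpow M i)"
    using fin i by (simp add: coeff_sum)
  with i have "?p \<noteq> 0"
    by force
  ultimately show ?thesis by blast
next
  case False
  then obtain i j where ij: "i \<noteq> j" "mpow M i = mpow M j"
    by (auto simp: inj_def)
  have "mpoly_eval (monom 1 i + monom (-1) j) M = 0"
    using ij by (simp add: mpoly_eval_add mpoly_eval_monom) (intro cmat_eqI, simp)
  moreover have "coeff (monom 1 i + monom (-1) j :: complex poly) i = 1"
    using ij by simp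
  ultimately show ?thesis
    by (metis coeff_0 zero_neq_one)
qed

text \<open>A primary decomposition in disguise: an annihilating polynomial of \<open>M\<close> is stripped of one
  linear factor \<open>M - c\<close> at a time, and factors with \<open>c\<close> not an eigenvalue can be cancelled.\<close>

lemma cmat_vector_induct [consumes 0, case_names zero eigenvalue]:
  fixes M :: "'r::finite cmat"
  assumes zero: "P 0"
    and step: "\<And>c v. eigenvalue M c \<Longrightarrow> P (M *v v - c *s v) \<Longrightarrow> P v"
  shows "P v"
proof -
  have "P v" if "p \<noteq> 0" "mpoly_eval p M *v v = 0" for p v
    using that
  proof (induction "degree p" arbitrary: p v)
    case 0
    then obtain a where a: "p = [:a:]" "a \<noteq> 0"
      by (metis degree_eq_zeroE pCons_0_0)
    with "0.prems" have "a *s v = 0"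
      by (metis add.right_neutral cscale_mult_vec mat_eq_cscale matrix_vector_mul_lid mpoly_eval_0 mpoly_eval_pCons times0_right)
    with a have "v = 0" by simp
    with zero show ?case by simp
  next
    case (Suc d)
    have "\<not> constant (poly p)"
      using Suc.hyps(2) by (simp add: constant_degree)
    then obtain c where "poly p c = 0"
      using fundamental_theorem_of_algebra by blast
    then obtain q where q: "p = [:- c, 1:] * q"
      by (metis dvdE poly_eq_0_iff_dvd)
    have "q \<noteq> 0"
      using q Suc.prems(1) by auto
    then have d: "d = degree q"
      using q Suc.hyps(2) degree_mult_eq[of "[:- c, 1:]" q] by simp
    have "(M - mat c) *v (mpoly_eval q M *v v) = 0"
      using Suc.prems(2) by (simp only: q mpoly_eval_linear_mult matrix_vector_mul_assoc)
    moreover have mc: "(M - mat c) *v u = M *v u - c *s u" for u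
      by (simp add: matrix_vector_mult_diff_rdistrib mat_eq_cscale[of c] cscale_mult_vec)
    ultimately have ev: "M *v (mpoly_eval q M *v v) = c *s (mpoly_eval q M *v v)"
      by simp
    show ?case
    proof (cases "eigenvalue M c")
      case True
      have "mpoly_eval q M *v ((M - mat c) *v v) = 0"
        using Suc.prems(2) mpoly_eval_commute[of "M - mat c" M q]
        by (simp add: q mpoly_eval_linear_mult matrix_vector_mul_assoc matrix_mul_diff_left matrix_mul_diff_right
              del: mult_pCons_left mult_pCons_right)
      then have "P (M *v v - c *s v)"
        using Suc.hyps(1)[OF d \<open>q \<noteq> 0\<close>] by (simp add: mc)
      with True step show ?thesis by blast
    next
      case False
      with ev have "mpoly_eval q M *v v = 0"
        unfolding eigenvalue_def by blast
      then show ?thesis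
        by (rule Suc.hyps(1)[OF d \<open>q \<noteq> 0\<close>])
    qed
  qed
  then show ?thesis
    using exists_annihilating_poly[of M] by (metis matrix_vector_mult_0)
qed

subsection \<open>Exponential decay for positive stable matrices\<close>

lemma positive_stable_mexp_vec_decay:
  fixes M :: "'r::finite cmat"
  assumes "positive_stable M"
  shows "\<exists>C \<delta>. \<delta> > 0 \<and> (\<forall>s\<ge>0. \<forall>i. norm ((mexp (of_real (- s) *\<^sub>m M) *v v) $ i) \<le> C * exp (- \<delta> * s))"
proof (induction v rule: cmat_vector_induct[where M = M])
  case zero
  show ?case by (intro exI[of _ 0] exI[of _ 1]) simp
next
  case (eigenvalue c v)
  define w where "w = M *v v - c *s v"
  obtain C \<delta>' where C: "\<delta>' > 0"
    "\<And>s i. s \<ge> 0 \<Longrightarrow> norm ((mexp (of_real (- s) *\<^sub>m M) *v w) $ i) \<le> C * exp (- \<delta>' * s)"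
    using eigenvalue.IH unfolding w_def by blast
  have "C \<ge> 0"
    using C(2)[of 0 undefined] by (metis exp_zero mult.right_neutral mult_zero_right norm_ge_zero order_refl order_trans)
  have "Re c > 0"
    using assms eigenvalue.hyps by (simp add: positive_stable_def)
  define \<delta> where "\<delta> = min \<delta>' (Re c / 2)"
  have \<delta>: "\<delta> > 0" "\<delta> \<le> \<delta>'" "\<delta> < Re c"
    using \<open>Re c > 0\<close> C(1) by (auto simp: \<delta>_def)
  define K where "K = C / (Re c - \<delta>)"
  have "norm ((mexp (of_real (- s) *\<^sub>m M) *v v) $ i) \<le> (norm v + K) * exp (- \<delta> * s)"
    if "s \<ge> 0" for s i
  proof (cases "s = 0")
    case True
    have "norm ((mexp 0 *v v) $ i) \<le> norm v"
      by (simp add: mexp_zero Finite_Cartesian_Product.norm_nth_le)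
    moreover have "K \<ge> 0" using \<open>C \<ge> 0\<close> \<delta> by (simp add: K_def)
    ultimately show ?thesis using True by simp
  next
    case False
    then have s: "s > 0" using that by simp
    define y where "y = (\<lambda>s. exp (c * of_real s) * (mexp (of_real (- s) *\<^sub>m M) *v v) $ i)"
    define y' where "y' = (\<lambda>s. - exp (c * of_real s) * (mexp (of_real (- s) *\<^sub>m M) *v w) $ i)"
    have der: "(y has_vector_derivative y' s) (at s)" for s
    proof -
      have "((\<lambda>z. exp (c * z) * (mexp ((- z) *\<^sub>m M) *v v) $ i) has_field_derivative
          exp (c * of_real s) * (c * (mexp ((- of_real s) *\<^sub>m M) *v v) $ i
            - (mexp ((- of_real s) *\<^sub>m M) *v (M *v v)) $ i)) (at (of_real s))"
        by (rule derivative_eq_intros DERIV_chain2[OF mexp_mult_vec_has_field_derivative] refl)+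
           (simp add: algebra_simps)
      from has_vector_derivative_real_field[OF this]
      show ?thesis
        unfolding y_def y'_def w_def
        by (simp add: o_def matrix_vector_mult_diff_distrib vector_scalar_commute algebra_simps)
    qed
    have "norm (y s - y 0) \<le> K * exp ((Re c - \<delta>) * s) - K * exp ((Re c - \<delta>) * 0)"
    proof (rule differentiable_bound_general[OF s])
      show "continuous_on {0..s} y"
        using der by (intro continuous_at_imp_continuous_on) (auto intro: has_vector_derivative_continuous)
      show "continuous_on {0..s} (\<lambda>s. K * exp ((Re c - \<delta>) * s))"
        by (intro continuous_intros)
      show "(y has_vector_derivative y' x) (at x)" for x
        by (rule der)
      show "((\<lambda>s. K * exp ((Re c - \<delta>) * s)) has_vector_derivative C * exp ((Re c - \<delta>) * x)) (at x)" for x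
        unfolding K_def using \<delta> 
        by (auto intro!: derivative_eq_intros simp flip: has_real_derivative_iff_has_vector_derivative)
      show "norm (y' x) \<le> C * exp ((Re c - \<delta>) * x)" if "0 < x" for x
      proof -
        have "norm (y' x) \<le> exp (Re c * x) * (C * exp (- \<delta>' * x))"
          using C(2)[of x i] that by (simp add: y'_def norm_mult)
        also have "\<dots> \<le> exp (Re c * x) * (C * exp (- \<delta> * x))"
          using \<delta> that \<open>C \<ge> 0\<close> by (intro mult_left_mono) auto
        also have "\<dots> = C * exp ((Re c - \<delta>) * x)"
          by (simp add: exp_add[symmetric] algebra_simps)
        finally show ?thesis .
      qed
    qed
    moreover have "norm (y 0) \<le> norm v"
      by (simp add: y_def mexp_zero Finite_Cartesian_Product.norm_nth_le)
    moreover have "K \<ge> 0" using \<open>C \<ge> 0\<close> \<delta> by (simp add: K_def)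
    ultimately have "norm (y s) \<le> norm v + K * exp ((Re c - \<delta>) * s)"
      using norm_triangle_sub[of "y s" "y 0"] by simp
    also have "\<dots> \<le> (norm v + K) * exp ((Re c - \<delta>) * s)"
      using \<delta> s by (simp add: distrib_right mult_le_cancel_left1)
    finally have "norm (y s) \<le> (norm v + K) * exp ((Re c - \<delta>) * s)" .
    then have "exp (Re c * s) * norm ((mexp (of_real (- s) *\<^sub>m M) *v v) $ i)
        \<le> exp (Re c * s) * ((norm v + K) * exp (- \<delta> * s))"
      by (simp add: y_def norm_mult algebra_simps exp_diff exp_minus divide_inverse)
    then show ?thesis by simp
  qed
  with \<delta> show ?case by blast
qed

lemma positive_stable_mexp_decay:
  fixes M :: "'r::finite cmat"
  assumes "positive_stable M"
  obtains C \<delta> where "C > 0" "\<delta> > 0" "\<And>s. s \<ge> 0 \<Longrightarrow> norm (mexp (of_real (- s) *\<^sub>m M)) \<le> C * exp (- \<delta> * s)"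
proof -
  have "\<forall>j. \<exists>C \<delta>. \<delta> > 0 \<and> (\<forall>s\<ge>0. \<forall>i. norm (mexp (of_real (- s) *\<^sub>m M) $ i $ j) \<le> C * exp (- \<delta> * s))"
    using positive_stable_mexp_vec_decay[OF assms, of "axis j 1" for j]
    unfolding mult_axis_nth by blast
  then obtain C \<delta> where C: "\<And>j. \<delta> j > 0" 
    "\<And>s i j. s \<ge> 0 \<Longrightarrow> norm (mexp (of_real (- s) *\<^sub>m M) $ i $ j) \<le> C j * exp (- \<delta> j * s)"
    by metis
  define d where "d = Min (range \<delta>)"
  define K where "K = (\<Sum>i\<in>(UNIV::'r set). \<Sum>j\<in>UNIV. \<bar>C j\<bar>) + 1"
  show ?thesis
  proof (rule that[of K d])
    show "d > 0" using C(1) by (auto simp: d_def)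
    show "K > 0" by (simp add: K_def add_nonneg_pos sum_nonneg)
    show "norm (mexp (of_real (- s) *\<^sub>m M)) \<le> K * exp (- d * s)" if s: "s \<ge> 0" for s
    proof -
      let ?E = "mexp (of_real (- s) *\<^sub>m M)"
      have "norm ?E \<le> (\<Sum>i\<in>UNIV. norm (?E $ i))"
        unfolding norm_vec_def[of ?E] by (rule L2_set_le_sum) simp
      also have "\<dots> \<le> (\<Sum>i\<in>UNIV. \<Sum>j\<in>UNIV. norm (?E $ i $ j))"
        by (intro sum_mono) (simp add: norm_vec_def L2_set_le_sum)
      also have "\<dots> \<le> (\<Sum>i\<in>(UNIV::'r set). \<Sum>j\<in>UNIV. \<bar>C j\<bar> * exp (- d * s))"
      proof (intro sum_mono)
        fix i j
        have "norm (?E $ i $ j) \<le> C j * exp (- \<delta> j * s)" by (rule C(2)[OF s])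
        also have "\<dots> \<le> \<bar>C j\<bar> * exp (- d * s)"
        proof (rule mult_mono)
          have "d * s \<le> \<delta> j * s"
            using s by (intro mult_right_mono) (auto simp: d_def)
          then show "exp (- \<delta> j * s) \<le> exp (- d * s)" by simp
        qed auto
        finally show "norm (?E $ i $ j) \<le> \<bar>C j\<bar> * exp (- d * s)" .
      qed
      also have "\<dots> \<le> K * exp (- d * s)"
        unfolding K_def sum_distrib_right[symmetric] by (intro mult_right_mono) auto
      finally show ?thesis .
    qed
  qed
qed

subsection \<open>The matrix Gamma function\<close>

lemma continuous_on_mexp_cscale: "continuous_on UNIV (\<lambda>s. mexp (s *\<^sub>m (M :: 'r::finite cmat)))"
proof -
  have "continuous_on UNIV (\<lambda>s. mexp (s *\<^sub>m M) $ i $ j)" for i j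
  proof -
    have "isCont (\<lambda>s. (mexp (s *\<^sub>m M) *v axis j 1) $ i) s" for s
      using mexp_mult_vec_has_field_derivative by (rule DERIV_isCont)
    then show ?thesis
      unfolding mult_axis_nth by (simp add: continuous_at_imp_continuous_on)
  qed
  then have "continuous_on UNIV (\<lambda>s. \<chi> i j. mexp (s *\<^sub>m M) $ i $ j)"
    by (intro continuous_on_vec_lambda)
  then show ?thesis by simp
qed

lemma continuous_on_mpowr_of_real: "continuous_on {0<..} (\<lambda>t. mpowr (complex_of_real t) M)"
proof (rule continuous_on_eq)
  show "continuous_on {0<..} (\<lambda>t. mexp (complex_of_real (ln t) *\<^sub>m M))"
    by (rule continuous_on_compose2[OF continuous_on_mexp_cscale]) (auto intro!: continuous_intros)
qed (simp add: mpowr_def Ln_of_real)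

lemma norm_mpowr_le:
  assumes "t > 0"
  shows "norm (mpowr (of_real t) M) \<le> norm (mat 1 :: 'r::finite cmat) * exp (\<bar>ln t\<bar> * norm (M :: 'r cmat))"
  using norm_mexp_le[of "of_real (ln t) *\<^sub>m M"] assms by (simp add: mpowr_def Ln_of_real norm_cscale)

lemma set_integrable_Gamma_real:
  fixes x :: real
  assumes "x > 0"
  shows "set_integrable lborel {0<..} (\<lambda>t. t powr (x - 1) * exp (- t))"
proof -
  have "(\<lambda>t. complex_of_real t powr (of_real x - 1) / of_real (exp t)) absolutely_integrable_on {0<..}"
    by (rule absolutely_integrable_Gamma_integral') (use assms in simp)
  then have "set_integrable lebesgue {0<..} (\<lambda>t. norm (complex_of_real t powr (of_real x - 1) / of_real (exp t)))"
    by (rule set_integrable_norm)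
  also have "?this \<longleftrightarrow> set_integrable lebesgue {0<..} (\<lambda>t. t powr (x - 1) * exp (- t))"
    by (rule set_integrable_cong)
       (auto simp: norm_mult norm_inverse norm_powr_real_powr exp_minus divide_inverse simp del: of_real_exp)
  finally show ?thesis
    unfolding set_integrable_def by (subst (asm) integrable_completion) simp_all
qed

lemma set_integrable_mGamma:
  fixes A :: "'r::finite cmat"
  assumes "positive_stable A"
  shows "set_integrable lborel {0<..} (\<lambda>t. of_real (exp (- t)) *\<^sub>m mpowr (of_real t) (A - mat 1))"
proof -
  obtain C \<delta> where C: "C > 0" "\<delta> > 0" "\<And>s. s \<ge> 0 \<Longrightarrow> norm (mexp (of_real (- s) *\<^sub>m A)) \<le> C * exp (- \<delta> * s)"
    using positive_stable_mexp_decay[OF assms] by blast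
  define a where "a = norm A + 1"
  define K where "K = norm (mat 1 :: 'r cmat)"
  have "a > 0" by (simp add: a_def add_nonneg_pos)
  show ?thesis
  proof (rule set_integrable_bound)
    show "set_integrable lborel {0<..} (\<lambda>t. C * (t powr (\<delta> - 1) * exp (- t)) + K * (t powr (a - 1) * exp (- t)))"
      using C \<open>a > 0\<close> by (intro set_integral_add set_integrable_mult_right set_integrable_Gamma_real) auto
    show "set_borel_measurable lborel {0<..} (\<lambda>t. of_real (exp (- t)) *\<^sub>m mpowr (of_real t) (A - mat 1))"
      unfolding set_borel_measurable_def
    proof (simp, rule borel_measurable_continuous_on_indicator)
      have "continuous_on {0<..} (\<lambda>t. exp (- t) *\<^sub>R mpowr (of_real t) (A - mat 1))"
        by (intro continuous_intros continuous_on_mpowr_of_real)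
      then show "continuous_on {0<..} (\<lambda>t. of_real (exp (- t)) *\<^sub>m mpowr (of_real t) (A - mat 1))"
        by (simp add: scaleR_eq_cscale)
    qed simp
    show "AE t in lborel. t \<in> {0<..} \<longrightarrow> norm (of_real (exp (- t)) *\<^sub>m mpowr (of_real t) (A - mat 1))
        \<le> norm (C * (t powr (\<delta> - 1) * exp (- t)) + K * (t powr (a - 1) * exp (- t)))"
    proof (rule AE_I2, rule impI)
      fix t :: real assume "t \<in> {0<..}"
      then have t: "t > 0" by simp
      have "norm (mpowr (of_real t) A) \<le> C * t powr \<delta> + K * t powr a"
      proof (cases "t \<le> 1")
        case True
        have "norm (mpowr (of_real t) A) \<le> C * t powr \<delta>"
          using C(3)[of "- ln t"] t True by (simp add: mpowr_def Ln_of_real powr_def)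
        also have "\<dots> \<le> C * t powr \<delta> + K * t powr a" by (simp add: K_def)
        finally show ?thesis .
      next
        case False
        have "norm (mpowr (of_real t) A) \<le> K * exp (ln t * norm A)"
          using norm_mpowr_le[OF t, of A] False by (simp add: K_def)
        also have "\<dots> \<le> K * t powr a"
          using False by (intro mult_left_mono) (auto simp: K_def powr_def a_def algebra_simps)
        also have "\<dots> \<le> C * t powr \<delta> + K * t powr a" using C by simp
        finally show ?thesis .
      qed
      moreover have "mpowr (of_real t) (A - mat 1) = of_real (1 / t) *\<^sub>m mpowr (of_real t) A"
      proof -
        have "A - mat 1 = A + mat (- 1)"
          by (intro cmat_eqI) (simp add: mat_def)
        then have "mpowr (of_real t) (A - mat 1) = (of_real t powr (- 1)) *\<^sub>m mpowr (of_real t) A"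
          using t mpowr_add_mat[of "of_real t" A "- 1"] by (simp only: of_real_eq_0_iff)
        then show ?thesis
          by (simp add: powr_minus divide_inverse)
      qed
      ultimately have "norm (of_real (exp (- t)) *\<^sub>m mpowr (of_real t) (A - mat 1))
          \<le> exp (- t) / t * (C * t powr \<delta> + K * t powr a)"
        using t by (simp add: norm_cscale norm_divide mult_left_mono divide_right_mono)
      also have "\<dots> = C * (t powr (\<delta> - 1) * exp (- t)) + K * (t powr (a - 1) * exp (- t))"
        using t by (simp add: powr_diff field_simps)
      finally show "norm (of_real (exp (- t)) *\<^sub>m mpowr (of_real t) (A - mat 1))
        \<le> norm (C * (t powr (\<delta> - 1) * exp (- t)) + K * (t powr (a - 1) * exp (- t)))"
        by simp
    qed
  qed
qed

lemma set_lebesgue_integral_bounded_linear: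
  assumes "bounded_linear T" "set_integrable M S f"
  shows "set_lebesgue_integral M S (\<lambda>x. T (f x)) = T (set_lebesgue_integral M S f)"
  using integral_bounded_linear[OF assms(1) assms(2)[unfolded set_integrable_def]]
  by (simp add: set_lebesgue_integral_def linear_scale[OF bounded_linear.linear[OF assms(1)]])

lemma set_lebesgue_integral_commute:
  fixes f :: "'a \<Rightarrow> 'r::finite cmat"
  assumes "\<And>x. x \<in> S \<Longrightarrow> N ** f x = f x ** N"
  shows "N ** set_lebesgue_integral M S f = set_lebesgue_integral M S f ** N"
proof (cases "set_integrable M S f")
  case True
  have "N ** set_lebesgue_integral M S f = set_lebesgue_integral M S (\<lambda>x. N ** f x)"
    by (rule set_lebesgue_integral_bounded_linear[OF bounded_linear_mul_right True, symmetric])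
  also have "\<dots> = set_lebesgue_integral M S (\<lambda>x. f x ** N)"
    unfolding set_lebesgue_integral_def using assms
    by (intro Bochner_Integration.integral_cong) (auto split: split_indicator)
  also have "\<dots> = set_lebesgue_integral M S f ** N"
    by (rule set_lebesgue_integral_bounded_linear[OF bounded_linear_mul_left True])
  finally show ?thesis .
next
  case False
  then show ?thesis
    by (simp add: set_lebesgue_integral_def set_integrable_def not_integrable_integral_eq)
qed

lemma mGamma_commute:
  assumes "N ** A = A ** (N :: 'r::finite cmat)"
  shows "N ** mGamma A = mGamma A ** N"
  unfolding mGamma_def
  by (rule set_lebesgue_integral_commute)
     (simp add: mpowr_commute matrix_mul_diff_left matrix_mul_diff_right assms)

lemma ext_beta_commute:
  assumes "N ** P = P ** N" "N ** Q = Q ** N" "N ** X = X ** (N :: 'r::finite cmat)"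
  shows "N ** ext_beta P Q X = ext_beta P Q X ** N"
  unfolding ext_beta_def
proof (rule set_lebesgue_integral_commute)
  fix t
  let ?a = "mpowr (of_real t) (P - mat 1)" and ?b = "mpowr (of_real (1 - t)) (Q - mat 1)"
    and ?c = "mexp (of_real (- 1 / (t * (1 - t))) *\<^sub>m X)"
  have "N ** ?a = ?a ** N"
    by (rule mpowr_commute) (simp add: matrix_mul_diff_left matrix_mul_diff_right assms)
  moreover have "N ** ?b = ?b ** N"
    by (rule mpowr_commute) (simp add: matrix_mul_diff_left matrix_mul_diff_right assms)
  moreover have "N ** ?c = ?c ** N"
    by (rule mexp_commute) (simp add: assms)
  ultimately show "N ** (?a ** ?b ** ?c) = ?a ** ?b ** ?c ** N"
    by (metis matrix_mul_assoc)
qed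

lemma mpowr_mult_eigenvector:
  assumes "M *v v = c *s v"
  shows "mpowr x M *v v = exp (c * Ln x) *s (v :: complex^'r::finite)"
proof -
  have pow: "mpow M n *v v = c ^ n *s v" for n
    by (induction n) (simp_all add: assms vector_scalar_commute flip: matrix_vector_mul_assoc)
  have "(mexp (Ln x *\<^sub>m M) *v v) $ i = exp (c * Ln x) * v $ i" for i
  proof (rule sums_unique2[OF mexp_cscale_mult_vec_sums])
    have "(\<lambda>n. (c * Ln x) ^ n /\<^sub>R fact n * v $ i) sums (exp (c * Ln x) * v $ i)"
      by (intro sums_mult2 exp_converges)
    then show "(\<lambda>n. (mpow M n *v v) $ i / fact n * Ln x ^ n) sums (exp (c * Ln x) * v $ i)"
      by (simp add: pow power_mult_distrib scaleR_conv_of_real field_simps)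
  qed
  then show ?thesis
    by (simp add: mpowr_def vec_eq_iff)
qed

lemma mGamma_mult_eigenvector:
  assumes A: "positive_stable A" and v: "A *v v = c *s v" "v \<noteq> 0"
  shows "mGamma A *v v = Gamma c *s (v :: complex^'r::finite)"
proof -
  have "Re c > 0"
    using assms by (auto simp: positive_stable_def eigenvalue_def)
  note int = set_integrable_mGamma[OF A]
  have ev: "(A - mat 1) *v v = (c - 1) *s v"
    by (simp add: matrix_vector_mult_diff_rdistrib v vector_sub_rdistrib)
  have "(mGamma A *v v) $ i = Gamma c * v $ i" for i
  proof -
    let ?g = "\<lambda>t. (of_real (exp (- t)) *\<^sub>m mpowr (of_real t) (A - mat 1) *v v) $ i"
    have "set_integrable lborel {0<..} ?g"
      using integrable_bounded_linear[OF bounded_linear_mul_vec_nth[of v i] int[unfolded set_integrable_def]]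
      by (simp add: set_integrable_def linear_scale[OF bounded_linear.linear[OF bounded_linear_mul_vec_nth]])
    then have "(LINT t:{0<..}|lborel. ?g t) = integral {0<..} ?g"
      by (rule set_borel_integral_eq_integral)
    also have "\<dots> = integral {0<..} (\<lambda>t. of_real t powr (c - 1) / of_real (exp t) * v $ i)"
      by (rule Henstock_Kurzweil_Integration.integral_cong)
         (simp add: cscale_mult_vec mpowr_mult_eigenvector[OF ev] powr_def exp_minus field_simps)
    also have "\<dots> = Gamma c * v $ i"
      by (intro integral_unique has_integral_mult_left Gamma_integral_complex' \<open>Re c > 0\<close>)
    finally show ?thesis
      unfolding mGamma_def set_lebesgue_integral_bounded_linear[OF bounded_linear_mul_vec_nth int] .
  qed
  then show ?thesis by (simp add: vec_eq_iff)
qed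

lemma invertible_mGamma:
  fixes A :: "'r::finite cmat"
  assumes A: "positive_stable A"
  shows "invertible (mGamma A)"
proof -
  have comm: "A ** mGamma A = mGamma A ** A"
    by (rule mGamma_commute) simp
  have "mGamma A *v v = 0 \<longrightarrow> v = 0" for v
  proof (induction v rule: cmat_vector_induct[where M = A])
    case (eigenvalue c v)
    show ?case
    proof
      assume v: "mGamma A *v v = 0"
      then have "mGamma A *v (A *v v) = 0"
        by (metis comm matrix_vector_mul_assoc matrix_vector_mult_0_right)
      with v have "mGamma A *v (A *v v - c *s v) = 0"
        by (simp add: matrix_vector_mult_diff_distrib vector_scalar_commute)
      with eigenvalue.IH have Av: "A *v v = c *s v"
        by simp
      show "v = 0"
      proof (rule ccontr)
        assume "v \<noteq> 0"
        then have "Gamma c *s v = 0"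
          using mGamma_mult_eigenvector[OF A Av] v by simp
        with \<open>v \<noteq> 0\<close> have "Gamma c = 0"
          by simp
        then have "c \<in> \<int>\<^sub>\<le>\<^sub>0"
          by (simp add: Gamma_eq_zero_iff)
        then have "Re c \<le> 0"
          by (auto elim!: nonpos_Ints_cases)
        with A eigenvalue.hyps show False
          by (auto simp: positive_stable_def)
      qed
    qed
  qed simp
  then show ?thesis
    by (simp add: invertible_left_inverse matrix_left_invertible_ker)
qed

lemma matrix_inv_commute:
  fixes N M :: "'r::finite cmat"
  assumes "invertible M" "N ** M = M ** N"
  shows "N ** matrix_inv M = matrix_inv M ** N"
proof -
  have inv: "M ** matrix_inv M = mat 1" "matrix_inv M ** M = mat 1"
    using someI_ex[OF assms(1)[unfolded invertible_def]] by (simp_all add: matrix_inv_def)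
  have "N ** matrix_inv M = matrix_inv M ** (M ** N) ** matrix_inv M"
    by (simp add: matrix_mul_assoc inv)
  also have "\<dots> = matrix_inv M ** N ** (M ** matrix_inv M)"
    by (simp only: assms(2)[symmetric] matrix_mul_assoc)
  finally show ?thesis
    by (simp add: inv)
qed

lemma positive_stable_mat: "Re c > 0 \<Longrightarrow> positive_stable (mat c :: 'r::finite cmat)"
  unfolding positive_stable_def eigenvalue_def mat_eq_cscale[of c] cscale_mult_vec
  by auto

subsection \<open>Moments of the extended beta function\<close>

lemma power_times_one_minus_power_le:
  fixes t :: real
  assumes "0 \<le> t" "t \<le> 1"
  shows "t ^ m * (1 - t) ^ N \<le> fact N / real (Suc m) ^ N"
proof -
  have le: "Suc m ^ N * fact m \<le> fact (m + N)"
  proof (induction N)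
    case (Suc N)
    have "Suc m ^ Suc N * fact m = Suc m * (Suc m ^ N * fact m)"
      by (simp only: power_Suc mult.assoc)
    also have "\<dots> \<le> Suc (m + N) * fact (m + N)"
      by (intro mult_mono Suc.IH) auto
    finally show ?case by (simp only: add_Suc_right fact_Suc of_nat_id)
  qed simp
  have "real (Suc m) ^ N / fact N \<le> real (m + N choose m)"
  proof -
    have "real (Suc m) ^ N * fact m \<le> fact (m + N)"
      using le by (metis of_nat_fact of_nat_le_iff of_nat_mult of_nat_power)
    then show ?thesis
      by (simp add: binomial_fact field_simps)
  qed
  then have "real (Suc m) ^ N / fact N * (t ^ m * (1 - t) ^ N) \<le> real (m + N choose m) * (t ^ m * (1 - t) ^ N)"
    using assms by (intro mult_right_mono) auto
  also have "\<dots> = (\<Sum>k\<in>{m}. of_nat (m + N choose k) * t ^ k * (1 - t) ^ (m + N - k))"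
    by simp
  also have "\<dots> \<le> (\<Sum>k\<le>m + N. of_nat (m + N choose k) * t ^ k * (1 - t) ^ (m + N - k))"
    using assms by (intro sum_mono2) auto
  also have "\<dots> = 1"
    using binomial_ring[of t "1 - t" "m + N"] by simp
  finally show ?thesis
    by (simp add: field_simps)
qed

lemma ln_le_linear:
  fixes a \<delta> :: real
  assumes "a \<ge> 0" "\<delta> > 0"
  obtains K where "\<And>y. y > 0 \<Longrightarrow> a * ln y \<le> \<delta> * y + K"
proof (cases "a = 0")
  case True
  then show ?thesis using that[of 0] assms by simp
next
  case False
  then have "a > 0" using assms by simp
  have "a * ln y \<le> \<delta> * y + a * ln (a / \<delta>)" if "y > 0" for y
  proof -
    have "ln (\<delta> * y / a) \<le> \<delta> * y / a"
      using \<open>a > 0\<close> assms that by (intro ln_bound) auto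
    moreover have "ln (\<delta> * y / a) = ln y - ln (a / \<delta>)"
      using \<open>a > 0\<close> assms that by (simp add: ln_mult ln_div)
    ultimately show ?thesis
      using \<open>a > 0\<close> by (simp add: field_simps)
  qed
  then show ?thesis using that by blast
qed

lemma norm_set_integral_unit_interval_le:
  fixes f :: "real \<Rightarrow> 'b::{banach, second_countable_topology}"
  assumes "\<And>t. 0 < t \<Longrightarrow> t < 1 \<Longrightarrow> norm (f t) \<le> D"
  shows "norm (LINT t:{0<..<1}|lborel. f t) \<le> D"
proof -
  have "D \<ge> 0"
    using order_trans[OF norm_ge_zero assms[of "1/2"]] by simp
  have "norm (LINT t:{0<..<1}|lborel. f t) \<le> (LINT t|lborel. norm (indicator {0<..<1} t *\<^sub>R f t))"
    unfolding set_lebesgue_integral_def by (rule integral_norm_bound)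
  also have "\<dots> \<le> (LINT t|lborel. indicator {0<..<1::real} t *\<^sub>R D)"
    using assms \<open>D \<ge> 0\<close> by (intro integral_mono') (auto simp: integrable_real_indicator split: split_indicator)
  also have "\<dots> = D"
    by simp
  finally show ?thesis .
qed

text \<open>The exponential of \<open>- X / (t (1 - t))\<close> beats every power of \<open>t\<close> and \<open>1 - t\<close>, whence the moments
  decay faster than every power of \<open>m\<close>.\<close>

lemma norm_ext_beta_le:
  fixes A Q X :: "'r::finite cmat"
  assumes "positive_stable X"
  obtains C where "C \<ge> 0" "\<And>m. norm (ext_beta (A + mat (of_nat m)) Q X) \<le> C / real (Suc m) ^ N"
proof -
  obtain C \<delta> where C: "C > 0" "\<delta> > 0" "\<And>s. s \<ge> 0 \<Longrightarrow> norm (mexp (of_real (- s) *\<^sub>m X)) \<le> C * exp (- \<delta> * s)"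
    using positive_stable_mexp_decay[OF assms] by blast
  define r where "r = norm (mat 1 :: 'r cmat)"
  define a where "a = norm (A - mat 1)"
  define b where "b = norm (Q - mat 1)"
  obtain K where K: "\<And>y. y > 0 \<Longrightarrow> a * ln y \<le> \<delta> * y + K"
    using ln_le_linear[of a \<delta>] C by (auto simp: a_def)
  obtain L where L: "\<And>y. y > 0 \<Longrightarrow> (b + N) * ln y \<le> \<delta> * y + L"
    using ln_le_linear[of "b + N" \<delta>] C by (auto simp: b_def)
  define D where "D = r * r * C * exp (K + L)"
  have "D \<ge> 0" using C by (simp add: D_def r_def)
  have "norm (ext_beta (A + mat (of_nat m)) Q X) \<le> D * (fact N / real (Suc m) ^ N)" for m
    unfolding ext_beta_def
  proof (rule norm_set_integral_unit_interval_le)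
    fix t :: real assume t: "0 < t" "t < 1"
    let ?a = "mpowr (of_real t) (A - mat 1)" and ?b = "mpowr (of_real (1 - t)) (Q - mat 1)"
      and ?c = "mexp (of_real (- 1 / (t * (1 - t))) *\<^sub>m X)"
    have "A + mat (of_nat m) - mat 1 = (A - mat 1) + mat (of_nat m)"
      by simp
    moreover have "mpowr (of_real t) ((A - mat 1) + mat (of_nat m)) = of_real t powr of_nat m *\<^sub>m ?a"
      using t by (intro mpowr_add_mat) simp
    moreover have "of_real t powr of_nat m = complex_of_real t ^ m"
      using t by (intro powr_nat') simp
    ultimately have eq: "mpowr (of_real t) (A + mat (of_nat m) - mat 1) = of_real t ^ m *\<^sub>m ?a"
      by (simp only:)
    have na: "norm ?a \<le> r * exp (a * - ln t)"
      using norm_mpowr_le[OF t(1), of "A - mat 1"] t by (simp add: r_def a_def mult.commute)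
    have nb: "norm ?b \<le> r * exp (b * - ln (1 - t))"
      using norm_mpowr_le[of "1 - t" "Q - mat 1"] t by (simp add: r_def b_def mult.commute)
    have nc: "norm ?c \<le> C * exp (- \<delta> * (1 / t + 1 / (1 - t)))"
    proof -
      have "1 / (t * (1 - t)) = 1 / t + 1 / (1 - t)"
        using t by (simp add: field_simps)
      then show ?thesis
        using C(3)[of "1 / (t * (1 - t))"] t by simp
    qed
    have "norm (?a ** ?b ** ?c) \<le> norm ?a * norm ?b * norm ?c"
      by (rule order_trans[OF norm_matrix_mul_le]) (intro mult_right_mono norm_matrix_mul_le, simp)
    also have "\<dots> \<le> (r * exp (a * - ln t)) * (r * exp (b * - ln (1 - t))) * (C * exp (- \<delta> * (1 / t + 1 / (1 - t))))"
      using C by (intro mult_mono na nb nc mult_nonneg_nonneg) (auto simp: r_def)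
    also have "\<dots> = r * r * C * exp (a * - ln t + b * - ln (1 - t) + - \<delta> * (1 / t + 1 / (1 - t)))"
      by (simp only: exp_add mult_ac)
    also have "\<dots> \<le> r * r * C * exp (K + L + N * ln (1 - t))"
    proof -
      have "a * - ln t \<le> \<delta> * (1 / t) + K"
        using K[of "1 / t"] t by (simp add: ln_div)
      moreover have "(b + N) * - ln (1 - t) \<le> \<delta> * (1 / (1 - t)) + L"
        using L[of "1 / (1 - t)"] t by (simp add: ln_div)
      ultimately show ?thesis
        using C by (intro mult_left_mono) (auto simp: r_def algebra_simps)
    qed
    also have "\<dots> = D * (1 - t) ^ N"
      using t by (simp add: D_def exp_add exp_of_nat_mult)
    finally have "norm (?a ** ?b ** ?c) \<le> D * (1 - t) ^ N" .
    then have "t ^ m * norm (?a ** ?b ** ?c) \<le> t ^ m * (D * (1 - t) ^ N)"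
      using t by (intro mult_left_mono) auto
    also have "\<dots> = D * (t ^ m * (1 - t) ^ N)" by simp
    also have "\<dots> \<le> D * (fact N / real (Suc m) ^ N)"
      using t \<open>D \<ge> 0\<close> by (intro mult_left_mono power_times_one_minus_power_le) auto
    finally show "norm (mpowr (of_real t) (A + mat (of_nat m) - mat 1) ** ?b ** ?c) \<le> D * (fact N / real (Suc m) ^ N)"
      using t by (simp only: eq cscale_mult_left norm_cscale norm_power norm_of_real abs_of_pos)
  qed
  with \<open>D \<ge> 0\<close> show ?thesis
    by (intro that[of "D * fact N"]) auto
qed

subsection \<open>The binomial theorem for matrices\<close>

lemma has_sum_rows_columns:
  fixes f :: "'a \<times> 'b \<Rightarrow> 'c :: banach"
  assumes "f summable_on UNIV"
    and rows: "\<And>x. ((\<lambda>y. f (x, y)) has_sum g x) UNIV"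
    and columns: "\<And>y. ((\<lambda>x. f (x, y)) has_sum h y) UNIV"
  shows "\<exists>S. (g has_sum S) UNIV \<and> (h has_sum S) UNIV"
proof -
  obtain S where S: "(f has_sum S) UNIV"
    using assms(1) by (auto simp: summable_on_def)
  have "((\<lambda>(y, x). f (x, y)) has_sum S) UNIV = (f has_sum S) UNIV"
    by (rule has_sum_reindex_bij_witness[of _ prod.swap prod.swap]) auto
  with S have "(h has_sum S) UNIV"
    using columns
      has_sum_SigmaD[where f = "\<lambda>(y, x). f (x, y)" and S = S and A = UNIV and B = "\<lambda>_. UNIV" and g = h]
    by simp
  moreover have "(g has_sum S) UNIV"
    using has_sum_SigmaD[where f = f and S = S and A = UNIV and B = "\<lambda>_. UNIV" and g = g] S rows by simp
  ultimately show ?thesis by blast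
qed

lemma gbinomial_minus_mult_power:
  fixes a x :: "'a::field_char_0"
  shows "(- a gchoose n) * (- x) ^ n = pochhammer a n * x ^ n / fact n"
proof -
  have "(- a gchoose n) * (- x) ^ n = ((- 1) ^ n * (- 1) ^ n) * (pochhammer a n * x ^ n / fact n)"
    unfolding gbinomial_pochhammer minus_minus power_minus[of x]
    by (simp only: times_divide_eq_right times_divide_eq_left mult_ac)
  then show ?thesis
    by (simp only: minus_one_mult_self mult_1_left)
qed

lemma pochhammer_series_sums_real:
  fixes a x :: real
  assumes "\<bar>x\<bar> < 1"
  shows "(\<lambda>n. pochhammer a n * x ^ n / fact n) sums (1 - x) powr (- a)"
  using gen_binomial_real[of "- x" "- a"] assms by (simp add: gbinomial_minus_mult_power)

lemma pochhammer_series_sums_complex: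
  fixes a x :: complex
  assumes "norm x < 1"
  shows "(\<lambda>n. pochhammer a n * x ^ n / fact n) sums (1 - x) powr (- a)"
  using gen_binomial_complex[of "- x" "- a"] assms by (simp add: gbinomial_minus_mult_power)

lemma pochhammer_series_summable_on:
  fixes a x :: real
  assumes "a \<ge> 0" "0 \<le> x" "x < 1"
  shows "(\<lambda>n. pochhammer a n * x ^ n / fact n) summable_on UNIV"
proof (rule summable_nonneg_imp_summable_on)
  show "summable (\<lambda>n. pochhammer a n * x ^ n / fact n)"
    using assms pochhammer_series_sums_real[of x a] by (auto intro: sums_summable)
  show "pochhammer a n * x ^ n / fact n \<ge> 0" for n
    unfolding pochhammer_prod using assms by (intro divide_nonneg_nonneg mult_nonneg_nonneg prod_nonneg) auto
qed

lemma mpochhammer_stirling: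
  "mpochhammer M n = (\<Sum>k\<le>n. of_nat (stirling n k) *\<^sub>m mpow (M :: 'r::finite cmat) k)"
proof (induction n)
  case (Suc n)
  have comm: "mpow M k ** M = M ** mpow M k" for k
    by (rule mpow_commute[symmetric]) simp
  have "mpochhammer M (Suc n) = mpochhammer M n ** M + of_nat n *\<^sub>m mpochhammer M n"
    by (simp add: matrix_add_ldistrib)
  also have "mpochhammer M n ** M = (\<Sum>k\<le>n. of_nat (stirling n k) *\<^sub>m mpow M (Suc k))"
    by (simp add: Suc.IH matrix_mul_sum_left comm)
  also have "of_nat n *\<^sub>m mpochhammer M n = (\<Sum>k\<le>Suc n. of_nat (n * stirling n k) *\<^sub>m mpow M k)"
    by (simp add: Suc.IH cscale_sum_right)
  also have "\<dots> = (\<Sum>k\<le>n. of_nat (n * stirling n (Suc k)) *\<^sub>m mpow M (Suc k))"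
    by (subst sum.atMost_Suc_shift) (cases n, simp_all)
  also have "(\<Sum>k\<le>n. of_nat (stirling n k) *\<^sub>m mpow M (Suc k)) + \<dots>
      = (\<Sum>k\<le>n. of_nat (stirling (Suc n) (Suc k)) *\<^sub>m mpow M (Suc k))"
    by (simp add: sum.distrib[symmetric] cscale_add_left[symmetric] add.commute)
  also have "\<dots> = (\<Sum>k\<le>Suc n. of_nat (stirling (Suc n) k) *\<^sub>m mpow M k)"
    by (subst sum.atMost_Suc_shift) simp
  finally show ?case .
qed simp

lemma norm_mpochhammer_le:
  "norm (mpochhammer M n) \<le> norm (mat 1 :: 'r::finite cmat) * pochhammer (norm (M :: 'r cmat)) n"
proof (induction n)
  case (Suc n)
  have "norm (mpochhammer M (Suc n)) \<le> norm (mpochhammer M n) * norm M + of_nat n * norm (mpochhammer M n)"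
    using norm_triangle_ineq[of "mpochhammer M n ** M" "of_nat n *\<^sub>m mpochhammer M n"]
      norm_matrix_mul_le[of "mpochhammer M n" M]
    by (simp add: matrix_add_ldistrib norm_cscale)
  also have "\<dots> = norm (mpochhammer M n) * (norm M + of_nat n)"
    by (simp add: algebra_simps)
  also have "\<dots> \<le> norm (mat 1 :: 'r cmat) * pochhammer (norm M) n * (norm M + of_nat n)"
    by (intro mult_right_mono Suc.IH) auto
  finally show ?case by (simp add: pochhammer_Suc mult.assoc)
qed simp

lemma stirling_series_summable_on:
  fixes a x :: real
  assumes "a \<ge> 0" "0 \<le> x" "x < 1"
  shows "(\<lambda>(n, k). real (stirling n k) * a ^ k * (x ^ n / fact n)) summable_on UNIV"
proof -
  have "(\<lambda>(n, k). real (stirling n k) * a ^ k * (x ^ n / fact n)) summable_on (SIGMA n:UNIV. UNIV)"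
  proof (rule summable_on_SigmaI)
    show "((\<lambda>k. case (n, k) of (n, k) \<Rightarrow> real (stirling n k) * a ^ k * (x ^ n / fact n))
        has_sum pochhammer a n * x ^ n / fact n) UNIV" for n
      by (rule has_sum_finite_neutralI[of "{..n}"])
         (auto simp: stirling_pochhammer[symmetric] sum_distrib_right sum_divide_distrib)
  qed (use assms in \<open>auto intro: pochhammer_series_summable_on\<close>)
  then show ?thesis by simp
qed

lemma stirling_exp_generating_function:
  fixes t :: complex
  assumes "norm t < 1"
  shows "((\<lambda>n. of_nat (stirling n k) * (t ^ n / fact n)) has_sum ((- Ln (1 - t)) ^ k / fact k)) UNIV"
proof -
  define c where "c = (\<lambda>k. \<Sum>\<^sub>\<infinity>n. of_nat (stirling n k) * (t ^ n / fact n))"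
  have sm: "(\<lambda>(n, k). of_nat (stirling n k) * a ^ k * (t ^ n / fact n)) summable_on UNIV" for a
    by (rule abs_summable_summable,
        rule summable_on_cong[THEN iffD1, OF _ stirling_series_summable_on[of "norm a" "norm t"]])
       (use assms in \<open>auto simp: norm_mult norm_power norm_divide\<close>)
  have col: "((\<lambda>n. of_nat (stirling n k) * (t ^ n / fact n)) has_sum c k) UNIV" for k
  proof -
    have "(\<lambda>(k, n). of_nat (stirling n k) * 1 ^ k * (t ^ n / fact n)) summable_on (SIGMA k:UNIV. UNIV)"
      using sm[of 1] by (subst (asm) summable_on_reindex_bij_witness[of _ prod.swap prod.swap]) auto
    from summable_on_SigmaD1[OF this, of k] show ?thesis
      unfolding c_def by (intro has_sum_infsum) simp
  qed
  have "((\<lambda>k. c k * a ^ k) has_sum exp (- Ln (1 - t) * a)) UNIV" for a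
  proof -
    have "\<exists>S. ((\<lambda>n. pochhammer a n * t ^ n / fact n) has_sum S) UNIV \<and> ((\<lambda>k. c k * a ^ k) has_sum S) UNIV"
    proof (rule has_sum_rows_columns[OF sm[of a]])
      show "((\<lambda>k. case (n, k) of (n, k) \<Rightarrow> of_nat (stirling n k) * a ^ k * (t ^ n / fact n))
        has_sum pochhammer a n * t ^ n / fact n) UNIV" for n
        by (rule has_sum_finite_neutralI[of "{..n}"])
           (auto simp: stirling_pochhammer[symmetric] sum_distrib_right sum_divide_distrib)
      show "((\<lambda>n. case (n, k) of (n, k) \<Rightarrow> of_nat (stirling n k) * a ^ k * (t ^ n / fact n)) has_sum c k * a ^ k) UNIV" for k
        using has_sum_cmult_left[OF col[of k], of "a ^ k"] by (simp add: mult_ac)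
    qed
    then obtain S where S: "((\<lambda>n. pochhammer a n * t ^ n / fact n) has_sum S) UNIV" "((\<lambda>k. c k * a ^ k) has_sum S) UNIV"
      by blast
    have "S = (1 - t) powr (- a)"
      using has_sum_imp_sums[OF S(1)] pochhammer_series_sums_complex[OF assms, of a] by (rule sums_unique2)
    also have "1 - t \<noteq> 0" using assms by auto
    then have "(1 - t) powr (- a) = exp (- Ln (1 - t) * a)"
      by (simp add: powr_def mult.commute)
    finally show ?thesis using S(2) by simp
  qed
  then have sums: "(\<lambda>k. c k * a ^ k) sums exp (- Ln (1 - t) * a)" for a
    by (rule has_sum_imp_sums)
  have "Abs_fps c = fps_exp (- Ln (1 - t))"
  proof (rule eval_fps_eqD)
    have "fps_conv_radius (Abs_fps c) = \<infinity>"
      unfolding fps_conv_radius_def by (rule conv_radius_inftyI'') (use sums in \<open>auto intro: sums_summable\<close>)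
    then show "fps_conv_radius (Abs_fps c) > 0" by simp
    show "\<forall>\<^sub>F a in nhds 0. eval_fps (Abs_fps c) a = eval_fps (fps_exp (- Ln (1 - t))) a"
      by (simp add: eval_fps_def[of "Abs_fps c"] sums_unique[OF sums, symmetric])
  qed simp
  then have "fps_nth (Abs_fps c) k = fps_nth (fps_exp (- Ln (1 - t))) k"
    by (simp only:)
  then have "c k = (- Ln (1 - t)) ^ k / fact k"
    by simp
  with col[of k] show ?thesis by (simp only:)
qed

text \<open>Expanding \<open>(M)\<^sub>n\<close> in powers of \<open>M\<close> by Stirling numbers and exchanging the sums reduces the
  binomial theorem for \<open>M\<close> to the scalar one, which determines the coefficient of each power.\<close>

lemma mpochhammer_binomial_series:
  fixes M :: "'r::finite cmat"
  assumes "norm t < 1"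
  shows "((\<lambda>n. (t ^ n / fact n) *\<^sub>m mpochhammer M n) has_sum mpowr (1 - t) (- M)) UNIV"
proof -
  let ?f = "\<lambda>(n, k). (of_nat (stirling n k) * (t ^ n / fact n)) *\<^sub>m mpow M k"
  let ?r = "norm (mat 1 :: 'r cmat)"
  have dominating: "(\<lambda>p. ?r * (case p of (n, k) \<Rightarrow> real (stirling n k) * norm M ^ k * (norm t ^ n / fact n))) summable_on UNIV"
    using assms by (intro summable_on_cmult_right[OF stirling_series_summable_on]) simp_all
  have sm: "?f summable_on UNIV"
  proof (rule abs_summable_summable, rule summable_on_comparison_test[OF dominating])
    fix p :: "nat \<times> nat"
    obtain n k where p: "p = (n, k)" by fastforce
    have "norm (?f p) = real (stirling n k) * (norm t ^ n / fact n) * norm (mpow M k)"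
      by (simp add: p norm_cscale norm_mult norm_power norm_divide)
    also have "\<dots> \<le> real (stirling n k) * (norm t ^ n / fact n) * (?r * norm M ^ k)"
      by (intro mult_left_mono norm_mpow_le) auto
    finally show "norm (?f p) \<le> ?r * (case p of (n, k) \<Rightarrow> real (stirling n k) * norm M ^ k * (norm t ^ n / fact n))"
      by (simp add: p mult_ac)
  qed simp
  have "\<exists>S. ((\<lambda>n. (t ^ n / fact n) *\<^sub>m mpochhammer M n) has_sum S) UNIV
      \<and> ((\<lambda>k. ((- Ln (1 - t)) ^ k / fact k) *\<^sub>m mpow M k) has_sum S) UNIV"
  proof (rule has_sum_rows_columns[OF sm])
    show "((\<lambda>k. ?f (n, k)) has_sum (t ^ n / fact n) *\<^sub>m mpochhammer M n) UNIV" for n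
      by (rule has_sum_finite_neutralI[of "{..n}"])
         (auto simp: mpochhammer_stirling cscale_sum_right mult.commute)
    show "((\<lambda>n. ?f (n, k)) has_sum ((- Ln (1 - t)) ^ k / fact k) *\<^sub>m mpow M k) UNIV" for k
      using has_sum_bounded_linear[OF bounded_linear_cscale_left stirling_exp_generating_function[OF assms]] by simp
  qed
  then obtain S where S: "((\<lambda>n. (t ^ n / fact n) *\<^sub>m mpochhammer M n) has_sum S) UNIV"
      "((\<lambda>k. ((- Ln (1 - t)) ^ k / fact k) *\<^sub>m mpow M k) has_sum S) UNIV"
    by blast
  have "(\<lambda>k. ((- Ln (1 - t)) ^ k / fact k) *\<^sub>m mpow M k) sums mexp ((- Ln (1 - t)) *\<^sub>m M)"
    using mexp_sums[of "(- Ln (1 - t)) *\<^sub>m M"] by (simp add: mpow_cscale)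
  then have "S = mpowr (1 - t) (- M)"
    using sums_unique2[OF has_sum_imp_sums[OF S(2)]] by (simp add: mpowr_def cscale_minus_left)
  with S(1) show ?thesis by simp
qed

lemma mpochhammer_add:
  "mpochhammer M (j + n) = mpochhammer M j ** mpochhammer (M + mat (of_nat j)) n"
  by (induction n) (simp_all add: matrix_mul_assoc mat_add add.assoc)

lemma mpochhammer_add_mat:
  "mpochhammer (M + mat c) n
     = (\<Sum>j\<le>n. (of_nat (n choose j) * pochhammer c j) *\<^sub>m mpochhammer (M :: 'r::finite cmat) (n - j))"
proof (induction n)
  case (Suc n)
  let ?f = "\<lambda>n j. (of_nat (n choose j) * pochhammer c j) *\<^sub>m mpochhammer M (n - j)"
  have step: "?f n j ** (M + mat c + mat (of_nat n))
      = (of_nat (n choose j) * pochhammer c j) *\<^sub>m mpochhammer M (Suc n - j)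
        + (of_nat (n choose j) * pochhammer c (Suc j)) *\<^sub>m mpochhammer M (n - j)" if "j \<le> n" for j
  proof -
    have "M + mat c + mat (of_nat n) = (M + mat (of_nat (n - j))) + mat (c + of_nat j)"
      using that by (simp only: add.assoc mat_add[symmetric]) (simp add: of_nat_diff add.commute)
    then have "mpochhammer M (n - j) ** (M + mat c + mat (of_nat n))
        = mpochhammer M (Suc n - j) + (c + of_nat j) *\<^sub>m mpochhammer M (n - j)"
      using that by (simp only: Suc_diff_le mpochhammer.simps mat_mult_right
          matrix_add_ldistrib[of _ "M + mat (of_nat (n - j))"])
    then show ?thesis
      by (simp only: cscale_mult_left cscale_add_right cscale_cscale pochhammer_Suc mult.assoc)
  qed
  have "mpochhammer (M + mat c) (Suc n) = (\<Sum>j\<le>n. ?f n j ** (M + mat c + mat (of_nat n)))"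
    by (simp only: mpochhammer.simps Suc.IH matrix_mul_sum_left)
  also have "\<dots> = (\<Sum>j\<le>n. (of_nat (n choose j) * pochhammer c j) *\<^sub>m mpochhammer M (Suc n - j))
      + (\<Sum>j\<le>n. (of_nat (n choose j) * pochhammer c (Suc j)) *\<^sub>m mpochhammer M (n - j))"
    unfolding sum.distrib[symmetric] by (intro sum.cong refl step) simp
  also have "(\<Sum>j\<le>n. (of_nat (n choose j) * pochhammer c j) *\<^sub>m mpochhammer M (Suc n - j))
      = (\<Sum>j\<le>Suc n. (of_nat (n choose j) * pochhammer c j) *\<^sub>m mpochhammer M (Suc n - j))"
    by (simp add: binomial_eq_0)
  also have "(\<Sum>j\<le>n. (of_nat (n choose j) * pochhammer c (Suc j)) *\<^sub>m mpochhammer M (n - j))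
      = (\<Sum>j\<le>Suc n. if j = 0 then 0 else (of_nat (n choose (j - 1)) * pochhammer c j) *\<^sub>m mpochhammer M (Suc n - j))"
    by (simp add: sum.atMost_Suc_shift del: sum.atMost_Suc)
  also have "(\<Sum>j\<le>Suc n. (of_nat (n choose j) * pochhammer c j) *\<^sub>m mpochhammer M (Suc n - j)) + \<dots>
     = (\<Sum>j\<le>Suc n. ?f (Suc n) j)"
    unfolding sum.distrib[symmetric]
  proof (rule sum.cong[OF refl])
    fix j assume "j \<in> {..Suc n}"
    show "(of_nat (n choose j) * pochhammer c j) *\<^sub>m mpochhammer M (Suc n - j)
        + (if j = 0 then 0 else (of_nat (n choose (j - 1)) * pochhammer c j) *\<^sub>m mpochhammer M (Suc n - j)) = ?f (Suc n) j"
      by (cases j) (simp_all add: algebra_simps flip: cscale_add_left)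
  qed
  finally show ?case .
qed simp

lemma pochhammer_minus_of_nat_div_fact:
  "pochhammer (- of_nat (k + j)) j / fact (k + j) = (- 1) ^ j / (fact k :: complex)"
proof -
  have "pochhammer (- of_nat (k + j)) j = (- 1) ^ j * (pochhammer (1 + of_nat k) j :: complex)"
    by (subst pochhammer_minus) (simp add: add.commute)
  moreover have "fact (k + j) = fact k * (pochhammer (1 + of_nat k) j :: complex)"
    by (simp add: pochhammer_fact pochhammer_product')
  moreover have "pochhammer (1 + of_nat k) j \<noteq> (0 :: complex)"
    using calculation(2) by (metis fact_nonzero mult_zero_right)
  ultimately show ?thesis by simp
qed

lemma has_sum_mpochhammer_shifted:
  fixes M :: "'r::finite cmat"
  assumes "norm t < 1"
  shows "((\<lambda>n. (t ^ n / fact n * pochhammer (- of_nat n) j) *\<^sub>m mpochhammer M n)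
     has_sum (- t / (1 - t)) ^ j *\<^sub>m (mpochhammer M j ** mpowr (1 - t) (- M))) UNIV"
proof -
  let ?g = "\<lambda>n. (t ^ n / fact n * pochhammer (- of_nat n) j) *\<^sub>m mpochhammer M n"
  let ?M = "M + mat (of_nat j)"
  have "((\<lambda>k. (- t) ^ j *\<^sub>m (mpochhammer M j ** ((t ^ k / fact k) *\<^sub>m mpochhammer ?M k)))
      has_sum (- t) ^ j *\<^sub>m (mpochhammer M j ** mpowr (1 - t) (- ?M))) UNIV"
    by (intro has_sum_bounded_linear[OF bounded_linear_cscale] has_sum_bounded_linear[OF bounded_linear_mul_right]
        mpochhammer_binomial_series assms)
  moreover have "(- t) ^ j *\<^sub>m (mpochhammer M j ** ((t ^ k / fact k) *\<^sub>m mpochhammer ?M k)) = ?g (k + j)" for k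
  proof -
    have "t ^ (k + j) / fact (k + j) * pochhammer (- of_nat (k + j)) j
        = t ^ (k + j) * (pochhammer (- of_nat (k + j)) j / fact (k + j))"
      by simp
    also have "\<dots> = (- t) ^ j * (t ^ k / fact k)"
      unfolding pochhammer_minus_of_nat_div_fact by (simp add: power_add power_minus[of t])
    finally show ?thesis
      using mpochhammer_add[of M j k] by (simp only: cscale_mult_right cscale_cscale add.commute[of k j])
  qed
  moreover have "(- t) ^ j *\<^sub>m (mpochhammer M j ** mpowr (1 - t) (- ?M))
      = (- t / (1 - t)) ^ j *\<^sub>m (mpochhammer M j ** mpowr (1 - t) (- M))"
  proof -
    have "1 - t \<noteq> 0" using assms by auto
    moreover have "- ?M = - M + mat (- of_nat j)"
      by (intro cmat_eqI) (simp add: mat_def)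
    ultimately have "mpowr (1 - t) (- ?M) = (1 - t) powr (- of_nat j) *\<^sub>m mpowr (1 - t) (- M)"
      by (simp only: mpowr_add_mat not_False_eq_True)
    also have "(1 - t) powr (- of_nat j) = inverse ((1 - t) ^ j)"
      using \<open>1 - t \<noteq> 0\<close> by (simp add: powr_minus powr_nat')
    finally show ?thesis
      by (simp only: cscale_mult_right cscale_cscale power_mult_distrib power_inverse divide_inverse)
  qed
  ultimately have "(?g \<circ> (\<lambda>k. k + j) has_sum
      (- t / (1 - t)) ^ j *\<^sub>m (mpochhammer M j ** mpowr (1 - t) (- M))) UNIV"
    by (simp only: o_def)
  then have "(?g has_sum (- t / (1 - t)) ^ j *\<^sub>m (mpochhammer M j ** mpowr (1 - t) (- M))) (range (\<lambda>k. k + j))"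
    by (subst has_sum_reindex) (auto simp: inj_on_def)
  also have "?this \<longleftrightarrow> ?thesis"
  proof (rule has_sum_cong_neutral)
    fix n assume "n \<in> UNIV - range (\<lambda>k. k + j)"
    then have "n < j"
      by (metis DiffD2 le_add_diff_inverse2 not_le rangeI)
    then show "?g n = 0"
      by (simp add: pochhammer_of_nat_eq_0_lemma)
  qed auto
  finally show ?thesis .
qed

subsection \<open>Rearrangement of the triple series\<close>

lemma mpochhammer_commute:
  assumes "N ** M = M ** (N :: 'r::finite cmat)"
  shows "N ** mpochhammer M n = mpochhammer M n ** N"
proof (induction n)
  case (Suc n)
  have "N ** mpochhammer M (Suc n) = mpochhammer M n ** (N ** (M + mat (of_nat n)))"
    by (simp add: Suc.IH matrix_mul_assoc)
  also have "N ** (M + mat (of_nat n)) = (M + mat (of_nat n)) ** N"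
    by (simp add: matrix_add_ldistrib matrix_add_rdistrib assms)
  finally show ?case
    by (simp add: matrix_mul_assoc)
qed simp

lemma has_sum_mult_nonneg:
  fixes f :: "'a \<Rightarrow> real" and g :: "'b \<Rightarrow> real"
  assumes f: "(f has_sum S) UNIV" "\<And>x. f x \<ge> 0" and g: "(g has_sum T) UNIV" "\<And>y. g y \<ge> 0"
  shows "((\<lambda>(x, y). f x * g y) has_sum S * T) UNIV"
proof -
  have rows: "((\<lambda>y. case (x, y) of (x, y) \<Rightarrow> f x * g y) has_sum f x * T) UNIV" for x
    using has_sum_cmult_right[OF g(1), of "f x"] by simp
  have total: "((\<lambda>x. f x * T) has_sum S * T) UNIV"
    by (rule has_sum_cmult_left[OF f(1)])
  have "(\<lambda>(x, y). f x * g y) summable_on (SIGMA x:UNIV. UNIV)"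
    using rows by (rule summable_on_SigmaI) (use f g total in \<open>auto simp: summable_on_def\<close>)
  from has_sum_SigmaI[OF rows total this] show ?thesis
    by simp
qed

lemma pochhammer_le_fact_mult_power:
  fixes b :: real
  assumes "b \<ge> 0" "b \<le> real p + 1"
  shows "pochhammer b n \<le> fact n * real (Suc n) ^ p"
proof (induction n)
  case (Suc n)
  have nonneg: "pochhammer b n \<ge> 0"
    unfolding pochhammer_prod using assms by (intro prod_nonneg) auto
  have "1 + real p * (1 / real (Suc n)) \<le> (1 + 1 / real (Suc n)) ^ p"
    by (rule Bernoulli_inequality) (use divide_nonneg_nonneg[of 1 "real (Suc n)"] in linarith)
  then have "real (Suc n) ^ p * (1 + real p * (1 / real (Suc n))) \<le> real (Suc n) ^ p * (1 + 1 / real (Suc n)) ^ p"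
    by (intro mult_left_mono) auto
  also have "\<dots> = real (Suc (Suc n)) ^ p"
    by (simp add: power_mult_distrib[symmetric] field_simps)
  finally have *: "real (Suc n) ^ p * (1 + real p * (1 / real (Suc n))) \<le> real (Suc (Suc n)) ^ p" .
  have "pochhammer b (Suc n) \<le> fact n * real (Suc n) ^ p * (b + real n)"
    using assms by (simp only: pochhammer_Suc) (intro mult_right_mono Suc.IH, auto)
  also have "\<dots> \<le> fact n * real (Suc n) ^ p * (real p + 1 + real n)"
    using assms by (intro mult_left_mono) auto
  also have "\<dots> = fact (Suc n) * (real (Suc n) ^ p * (1 + real p * (1 / real (Suc n))))"
    by (simp add: field_simps)
  also have "\<dots> \<le> fact (Suc n) * real (Suc (Suc n)) ^ p"
    by (intro mult_left_mono *) auto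
  finally show ?case .
qed simp

lemma pochhammer_div_power_summable_on:
  fixes b :: real
  assumes "b \<ge> 0"
  obtains N where "(\<lambda>i. pochhammer b i / fact i / real (Suc i) ^ N) summable_on UNIV"
proof -
  obtain p :: nat where p: "b \<le> real p + 1"
    using real_arch_simple[of b] by (meson add_increasing2 order_trans zero_le_one order_refl)
  have nonneg: "pochhammer b i \<ge> 0" for i
    unfolding pochhammer_prod using assms by (intro prod_nonneg) auto
  have "(\<lambda>i. inverse (real (Suc i) ^ 2)) summable_on UNIV"
  proof (rule summable_nonneg_imp_summable_on)
    show "summable (\<lambda>i. inverse (real (Suc i) ^ 2))"
      using inverse_power_summable[of 2, where 'a = real] by (subst summable_Suc_iff) simp
  qed simp
  then have "(\<lambda>i. pochhammer b i / fact i / real (Suc i) ^ (p + 2)) summable_on UNIV"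
  proof (rule summable_on_comparison_test)
    fix i :: nat
    have "pochhammer b i / fact i / real (Suc i) ^ (p + 2) \<le> (real (Suc i) ^ p) / real (Suc i) ^ (p + 2)"
    proof (rule divide_right_mono)
      show "pochhammer b i / fact i \<le> real (Suc i) ^ p"
        using pochhammer_le_fact_mult_power[OF assms p, of i] by (simp only: pos_divide_le_eq fact_gt_zero mult.commute)
    qed simp
    also have "\<dots> = inverse (real (Suc i) ^ 2)"
      unfolding power_add divide_inverse inverse_mult_distrib by simp
    finally show "pochhammer b i / fact i / real (Suc i) ^ (p + 2) \<le> inverse (real (Suc i) ^ 2)" .
    show "0 \<le> pochhammer b i / fact i / real (Suc i) ^ (p + 2)"
      using nonneg by simp
  qed
  then show ?thesis by (rule that)
qed

lemma norm_pochhammer_minus_of_nat: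
  "norm (pochhammer (- of_nat n) j / fact j :: complex) = real (n choose j)"
proof -
  have "of_nat (n choose j) = (- 1) ^ j * pochhammer (- of_nat n) j / (fact j :: complex)"
    by (simp add: binomial_gbinomial gbinomial_pochhammer)
  then have "norm (of_nat (n choose j) :: complex) = norm ((- 1) ^ j * pochhammer (- of_nat n) j / (fact j :: complex))"
    by (simp only:)
  then show ?thesis
    by (simp add: norm_mult norm_power norm_divide)
qed

lemma has_sum_binomial_power:
  "((\<lambda>j. real (n choose j) * x ^ j) has_sum (1 + x) ^ n) UNIV"
proof (rule has_sum_finite_neutralI[of "{..n}"])
  show "(1 + x) ^ n = (\<Sum>j\<le>n. real (n choose j) * x ^ j)"
    using binomial_ring[of x 1 n] by (simp add: add.commute)
qed auto

text \<open>Both sides are rearrangements of the triple series with general term \<open>f (n, i, j)\<close>.  Since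
  \<open>|(-n)\<^sub>j| / j! = n choose j\<close>, it converges absolutely for \<open>|t| (1 + |z|) < 1\<close>.\<close>

lemma pochhammer_moment_identity:
  fixes B B' :: "'r::finite cmat" and \<beta> :: "nat \<Rightarrow> 'r cmat" and z t :: complex
  assumes comm: "B ** B' = B' ** B" "\<And>m. B ** \<beta> m = \<beta> m ** B" "\<And>m. B' ** \<beta> m = \<beta> m ** B'"
    and decay: "\<And>N. \<exists>D\<ge>0. \<forall>m. norm (\<beta> m) \<le> D / real (Suc m) ^ N"
    and z: "norm z \<le> 1" and t: "norm t < 1 / (1 + norm z)"
  defines "w \<equiv> - z * t / (1 - t)"
  shows "\<exists>T. ((\<lambda>(i, j). (z ^ i * w ^ j / (fact i * fact j)) *\<^sub>m
                   (\<beta> (i + j) ** mpochhammer B i ** mpochhammer B' j)) has_sum T) UNIV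
           \<and> ((\<lambda>n. (t ^ n / fact n) *\<^sub>m (mpochhammer B' n **
                   (\<Sum>m. (z ^ m / fact m) *\<^sub>m (mpochhammer (B - mat (of_nat n)) m ** \<beta> m))))
              has_sum (mpowr (1 - t) (- B') ** T)) UNIV"
proof -
  define r where "r = norm (mat 1 :: 'r cmat)"
  define b where "b = norm B"
  define b' where "b' = norm B'"
  have nonneg: "r \<ge> 0" "b \<ge> 0" "b' \<ge> 0" "pochhammer b i \<ge> 0" "pochhammer b' i \<ge> 0" for i
    unfolding r_def b_def b'_def pochhammer_prod by (auto intro!: prod_nonneg)
  obtain N where N: "(\<lambda>i. pochhammer b i / fact i / real (Suc i) ^ N) summable_on UNIV"
    using pochhammer_div_power_summable_on[OF nonneg(2)] by blast
  obtain D where D: "D \<ge> 0" "\<And>m. norm (\<beta> m) \<le> D / real (Suc m) ^ N"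
    using decay by blast
  define H where "H = (\<lambda>i. pochhammer b i / fact i / real (Suc i) ^ N)"
  have H: "H i \<ge> 0" for i
    using nonneg by (simp add: H_def)
  obtain Htot where Htot: "(H has_sum Htot) UNIV"
    using N by (auto simp: summable_on_def H_def)
  have t': "norm t * (1 + norm z) < 1"
    using t by (simp add: pos_less_divide_eq add_pos_nonneg)
  have t1: "norm t < 1"
    using t' mult_left_mono[of 1 "1 + norm z" "norm t"] by simp
  have w1: "norm w < 1"
  proof (cases "z = 0")
    case False
    have "norm z * norm t < 1 - norm t"
      using t' by (simp add: algebra_simps)
    also have "\<dots> \<le> norm (1 - t)"
      using norm_triangle_ineq2[of 1 t] by simp
    finally have "norm z * norm t < norm (1 - t)" .
    then show ?thesis
      by (simp add: w_def norm_divide norm_mult divide_less_eq)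
  qed (simp add: w_def)

  have term_le: "norm (c *\<^sub>m (mpochhammer B i ** \<beta> (i + j))) \<le> norm c * fact i * (r * D * H i)" for c i j
  proof -
    have "norm (\<beta> (i + j)) \<le> D / real (Suc i) ^ N"
      by (rule order_trans[OF D(2)]) (use D(1) in \<open>auto intro!: divide_left_mono power_mono\<close>)
    then have "norm (mpochhammer B i) * norm (\<beta> (i + j)) \<le> (r * pochhammer b i) * (D / real (Suc i) ^ N)"
      using norm_mpochhammer_le[of B i] nonneg by (intro mult_mono) (auto simp: r_def b_def)
    also have "\<dots> = fact i * (r * D * H i)"
      by (simp add: H_def)
    finally have "norm (mpochhammer B i ** \<beta> (i + j)) \<le> fact i * (r * D * H i)"
      by (rule order_trans[OF norm_matrix_mul_le])
    then show ?thesis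
      by (simp add: norm_cscale mult.assoc mult_left_mono)
  qed

  define e where "e = (\<lambda>n (i, j). (pochhammer (- of_nat n) j * z ^ (i + j) / (fact i * fact j)) *\<^sub>m
    (mpochhammer B i ** \<beta> (i + j)))"
  have norm_e: "norm (e n (i, j)) \<le> r * D * (H i * (real (n choose j) * norm z ^ j))" for n i j
  proof -
    have "norm (e n (i, j)) \<le> norm (pochhammer (- of_nat n) j * z ^ (i + j) / (fact i * fact j)) * fact i * (r * D * H i)"
      unfolding e_def by (simp only: prod.case term_le)
    also have "norm (pochhammer (- of_nat n) j * z ^ (i + j) / (fact i * fact j)) * fact i
        = norm (pochhammer (- of_nat n) j / fact j :: complex) * norm z ^ (i + j)"
      by (simp add: norm_mult norm_divide norm_power)
    also have "\<dots> \<le> real (n choose j) * norm z ^ j"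
      unfolding norm_pochhammer_minus_of_nat using z
      by (intro mult_left_mono power_decreasing) auto
    finally show ?thesis
      using D(1) nonneg(1) H[of i] by (simp add: mult_ac mult_right_mono)
  qed
  have e_dominated: "((\<lambda>(i, j). H i * (real (n choose j) * norm z ^ j)) has_sum Htot * (1 + norm z) ^ n) UNIV" for n
    by (intro has_sum_mult_nonneg Htot H has_sum_binomial_power) auto
  have e_summable: "e n summable_on UNIV" for n
  proof (rule abs_summable_summable, rule summable_on_comparison_test)
    show "(\<lambda>p. r * D * (case p of (i, j) \<Rightarrow> H i * (real (n choose j) * norm z ^ j))) summable_on UNIV"
      using e_dominated[of n] by (intro summable_on_cmult_right) (auto simp: summable_on_def)
    show "norm (e n p) \<le> r * D * (case p of (i, j) \<Rightarrow> H i * (real (n choose j) * norm z ^ j))" for p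
      using norm_e by (cases p) simp
  qed simp

  define s where "s = (\<lambda>n. \<Sum>m. (z ^ m / fact m) *\<^sub>m (mpochhammer (B - mat (of_nat n)) m ** \<beta> m))"
  have e_sum: "(e n has_sum s n) UNIV" for n
  proof -
    obtain E where E: "(e n has_sum E) UNIV"
      using e_summable by (auto simp: summable_on_def)
    have "((\<lambda>(m, j). e n (m - j, j)) has_sum E) (SIGMA m:UNIV. {..m}) = (e n has_sum E) UNIV"
      by (rule has_sum_reindex_bij_witness[of _ "\<lambda>(i, j). (i + j, j)" "\<lambda>(m, j). (m - j, j)"]) auto
    with E have "((\<lambda>(m, j). e n (m - j, j)) has_sum E) (SIGMA m:UNIV. {..m})"
      by simp
    then have "((\<lambda>m. \<Sum>j\<le>m. e n (m - j, j)) has_sum E) UNIV"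
      by (rule has_sum_SigmaD) (auto intro: has_sum_finite)
    moreover have "(\<Sum>j\<le>m. e n (m - j, j)) = (z ^ m / fact m) *\<^sub>m (mpochhammer (B - mat (of_nat n)) m ** \<beta> m)" for m
    proof -
      have "B - mat (of_nat n) = B + mat (- of_nat n)"
        by (intro cmat_eqI) (simp add: mat_def)
      then have "(z ^ m / fact m) *\<^sub>m (mpochhammer (B - mat (of_nat n)) m ** \<beta> m)
          = (\<Sum>j\<le>m. (z ^ m / fact m * (of_nat (m choose j) * pochhammer (- of_nat n) j)) *\<^sub>m
              (mpochhammer B (m - j) ** \<beta> m))"
        by (simp only: mpochhammer_add_mat matrix_mul_sum_left cscale_sum_right cscale_mult_left cscale_cscale)
      also have "\<dots> = (\<Sum>j\<le>m. e n (m - j, j))"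
      proof (rule sum.cong[OF refl])
        fix j assume "j \<in> {..m}"
        then have "j \<le> m" by simp
        then have "z ^ m / fact m * (of_nat (m choose j) * pochhammer (- of_nat n) j)
            = pochhammer (- of_nat n) j * z ^ m / (fact (m - j) * fact j)"
          by (simp only: binomial_fact) (simp add: divide_inverse inverse_mult_distrib)
        with \<open>j \<le> m\<close> show "(z ^ m / fact m * (of_nat (m choose j) * pochhammer (- of_nat n) j)) *\<^sub>m
              (mpochhammer B (m - j) ** \<beta> m) = e n (m - j, j)"
          by (simp only: e_def prod.case le_add_diff_inverse2)
      qed
      finally show ?thesis by (rule sym)
    qed
    ultimately have "(\<lambda>m. (z ^ m / fact m) *\<^sub>m (mpochhammer (B - mat (of_nat n)) m ** \<beta> m)) sums E"
      by (simp add: has_sum_imp_sums)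
    then have "s n = E"
      unfolding s_def by (rule sums_unique[symmetric])
    with E show ?thesis by simp
  qed

  define f where "f = (\<lambda>(n, p). (t ^ n / fact n) *\<^sub>m (mpochhammer B' n ** e n p))"
  have f_summable: "f summable_on UNIV"
  proof (rule abs_summable_summable, rule summable_on_comparison_test)
    let ?g = "\<lambda>(n, i, j). pochhammer b' n * norm t ^ n / fact n * (H i * (real (n choose j) * norm z ^ j))"
    have "?g summable_on (SIGMA n:UNIV. UNIV)"
    proof (rule summable_on_SigmaI)
      show "((\<lambda>p. ?g (n, p)) has_sum pochhammer b' n * norm t ^ n / fact n * (Htot * (1 + norm z) ^ n)) UNIV" for n
        using has_sum_cmult_right[OF e_dominated[of n], of "pochhammer b' n * norm t ^ n / fact n"]
        by (simp add: case_prod_unfold)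
      have "(\<lambda>n. Htot * (pochhammer b' n * (norm t * (1 + norm z)) ^ n / fact n)) summable_on UNIV"
        using t' nonneg by (intro summable_on_cmult_right pochhammer_series_summable_on) auto
      then show "(\<lambda>n. pochhammer b' n * norm t ^ n / fact n * (Htot * (1 + norm z) ^ n)) summable_on UNIV"
        by (simp add: power_mult_distrib mult_ac)
    qed (use nonneg H in auto)
    then show "(\<lambda>q. r * (r * D) * ?g q) summable_on UNIV"
      by (intro summable_on_cmult_right) simp
    show "norm (f q) \<le> r * (r * D) * ?g q" for q
    proof -
      obtain n i j where q: "q = (n, i, j)" by (cases q)
      have "norm (f q) = norm t ^ n / fact n * norm (mpochhammer B' n ** e n (i, j))"
        by (simp add: q f_def norm_cscale norm_divide norm_power)
      also have "\<dots> \<le> norm t ^ n / fact n * ((r * pochhammer b' n) * (r * D * (H i * (real (n choose j) * norm z ^ j))))"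
        using norm_mpochhammer_le[of B' n] norm_e[of n i j] nonneg
        by (intro mult_left_mono order_trans[OF norm_matrix_mul_le] mult_mono) (auto simp: r_def b'_def)
      finally show ?thesis
        by (simp add: q mult_ac)
    qed
  qed simp

  define P where "P = mpowr (1 - t) (- B')"
  define g where "g = (\<lambda>(i, j). (z ^ i * w ^ j / (fact i * fact j)) *\<^sub>m
    (\<beta> (i + j) ** mpochhammer B i ** mpochhammer B' j))"
  have rearrange: "mpochhammer B' j ** P ** (mpochhammer B i ** \<beta> m) = P ** (\<beta> m ** mpochhammer B i ** mpochhammer B' j)"
    and rearrange': "mpochhammer B i ** \<beta> m ** mpochhammer B' j = \<beta> m ** mpochhammer B i ** mpochhammer B' j" for i j m
  proof -
    have 1: "P ** mpochhammer B' j = mpochhammer B' j ** P"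
      unfolding P_def
      by (intro mpochhammer_commute mpowr_commute[symmetric]) (simp add: matrix_mul_minus_left matrix_mul_minus_right)
    have 2: "\<beta> m ** mpochhammer B i = mpochhammer B i ** \<beta> m"
      by (intro mpochhammer_commute comm(2)[symmetric])
    have 3: "\<beta> m ** mpochhammer B' j = mpochhammer B' j ** \<beta> m"
      by (intro mpochhammer_commute comm(3)[symmetric])
    have 4: "mpochhammer B i ** mpochhammer B' j = mpochhammer B' j ** mpochhammer B i"
      by (intro mpochhammer_commute mpochhammer_commute[symmetric] comm(1)[symmetric])
    show "mpochhammer B' j ** P ** (mpochhammer B i ** \<beta> m) = P ** (\<beta> m ** mpochhammer B i ** mpochhammer B' j)"
      by (metis 1 2 3 4 matrix_mul_assoc)
    show "mpochhammer B i ** \<beta> m ** mpochhammer B' j = \<beta> m ** mpochhammer B i ** mpochhammer B' j"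
      by (simp only: 2)
  qed
  have g_summable: "g summable_on UNIV"
  proof (rule abs_summable_summable, rule summable_on_comparison_test)
    let ?k = "\<lambda>(i, j). H i * (pochhammer b' j * norm w ^ j / fact j)"
    obtain L where "((\<lambda>j. pochhammer b' j * norm w ^ j / fact j) has_sum L) UNIV"
      using pochhammer_series_summable_on[of b' "norm w"] w1 nonneg by (auto simp: summable_on_def)
    then have "(?k has_sum Htot * L) UNIV"
      using Htot H nonneg by (intro has_sum_mult_nonneg) auto
    then show "(\<lambda>p. r * D * r * ?k p) summable_on UNIV"
      by (intro summable_on_cmult_right) (auto simp: summable_on_def)
    show "norm (g p) \<le> r * D * r * ?k p" for p
    proof -
      obtain i j where p: "p = (i, j)" by (cases p)
      have "g p = (z ^ i * w ^ j / (fact i * fact j)) *\<^sub>m (mpochhammer B i ** \<beta> (i + j)) ** mpochhammer B' j"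
        by (simp add: p g_def rearrange')
      also have "norm \<dots> \<le> (norm (z ^ i * w ^ j / (fact i * fact j)) * fact i * (r * D * H i)) * (r * pochhammer b' j)"
        using norm_mpochhammer_le[of B' j] D(1) H[of i] nonneg
        by (intro order_trans[OF norm_matrix_mul_le] mult_mono term_le) (auto simp: r_def b'_def)
      also have "norm (z ^ i * w ^ j / (fact i * fact j)) * fact i = norm z ^ i * (norm w ^ j / fact j)"
        by (simp add: norm_mult norm_divide norm_power)
      also have "\<dots> * (r * D * H i) * (r * pochhammer b' j) \<le> 1 * (norm w ^ j / fact j) * (r * D * H i) * (r * pochhammer b' j)"
        using z D(1) H[of i] nonneg by (intro mult_right_mono power_le_one) auto
      finally show ?thesis
        by (simp add: p mult_ac)
    qed
  qed simp
  then obtain T where T: "(g has_sum T) UNIV"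
    by (auto simp: summable_on_def)

  have "\<exists>S. ((\<lambda>n. (t ^ n / fact n) *\<^sub>m (mpochhammer B' n ** s n)) has_sum S) UNIV \<and> ((\<lambda>p. P ** g p) has_sum S) UNIV"
  proof (rule has_sum_rows_columns[OF f_summable])
    show "((\<lambda>p. f (n, p)) has_sum (t ^ n / fact n) *\<^sub>m (mpochhammer B' n ** s n)) UNIV" for n
      unfolding f_def prod.case
      by (intro has_sum_bounded_linear[OF bounded_linear_cscale] has_sum_bounded_linear[OF bounded_linear_mul_right] e_sum)
    show "((\<lambda>n. f (n, p)) has_sum P ** g p) UNIV" for p
    proof -
      obtain i j where p: "p = (i, j)" by (cases p)
      define c where "c = z ^ (i + j) / (fact i * fact j)"
      have "((\<lambda>n. c *\<^sub>m ((t ^ n / fact n * pochhammer (- of_nat n) j) *\<^sub>m mpochhammer B' n ** (mpochhammer B i ** \<beta> (i + j))))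
          has_sum c *\<^sub>m ((- t / (1 - t)) ^ j *\<^sub>m (mpochhammer B' j ** P) ** (mpochhammer B i ** \<beta> (i + j)))) UNIV"
        unfolding P_def
        by (intro has_sum_bounded_linear[OF bounded_linear_cscale] has_sum_bounded_linear[OF bounded_linear_mul_left]
            has_sum_mpochhammer_shifted t1)
      moreover have "c *\<^sub>m ((t ^ n / fact n * pochhammer (- of_nat n) j) *\<^sub>m mpochhammer B' n ** (mpochhammer B i ** \<beta> (i + j)))
          = f (n, p)" for n
      proof -
        have "c * (t ^ n / fact n * pochhammer (- of_nat n) j)
            = t ^ n / fact n * (pochhammer (- of_nat n) j * z ^ (i + j) / (fact i * fact j))"
          unfolding c_def by (simp add: mult_ac)
        then show ?thesis
          by (simp only: f_def e_def p prod.case cscale_mult_left cscale_mult_right cscale_cscale)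
      qed
      moreover have "c *\<^sub>m ((- t / (1 - t)) ^ j *\<^sub>m (mpochhammer B' j ** P) ** (mpochhammer B i ** \<beta> (i + j))) = P ** g p"
      proof -
        have "c * (- t / (1 - t)) ^ j = z ^ i * w ^ j / (fact i * fact j)"
        proof -
          have "w = z * (- t / (1 - t))" by (simp add: w_def)
          then have "w ^ j = z ^ j * (- t / (1 - t)) ^ j"
            by (simp only: power_mult_distrib)
          then show ?thesis
            by (simp add: c_def power_add)
        qed
        then show ?thesis
          by (simp only: p g_def prod.case cscale_mult_left cscale_mult_right cscale_cscale rearrange)
      qed
      ultimately show ?thesis by (simp only:)
    qed
  qed
  then obtain S where S: "((\<lambda>n. (t ^ n / fact n) *\<^sub>m (mpochhammer B' n ** s n)) has_sum S) UNIV"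
    "((\<lambda>p. P ** g p) has_sum S) UNIV" by blast
  have "S = P ** T"
    using S(2) has_sum_bounded_linear[OF bounded_linear_mul_right T] by (rule has_sum_unique)
  with S(1) T show ?thesis
    unfolding g_def s_def P_def by blast
qed

theorem theorem5p2:
  fixes A B B' X :: "complex^'r::finite^'r" and \<mu> lam z t :: complex
  assumes "positive_stable A" and "positive_stable B" and "positive_stable B'"
    and "positive_stable X"
    and "A ** X = X ** A" and "A ** B = B ** A" and "A ** B' = B' ** A"
    and "B ** X = X ** B" and "B' ** X = X ** B'" and "B ** B' = B' ** B"
    and "Re \<mu> > Re lam" and "Re lam > 0"
    and "norm z \<le> 1" and "norm t < 1 / (1 + norm z)"
  shows "(\<lambda>n. (t ^ n / fact n) *\<^sub>m
            (mpochhammer B' n ** ext_gauss X (B - mat (of_nat n)) A (A + mat (\<mu> - lam)) z))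
         sums
         (mpowr (1 - t) (- B')
            ** ext_appell1 A B B' (A + mat (\<mu> - lam)) z (- z * t / (1 - t)) X)"
proof -
  define c where "c = \<mu> - lam"
  define w where "w = - z * t / (1 - t)"
  define \<beta> where "\<beta> = (\<lambda>m. ext_beta (A + mat (of_nat m)) (mat c) X)"
  define P where "P = mpowr (1 - t) (- B')"
  have [simp]: "A + mat c - A = mat c"
    by simp
  have comm: "N ** \<beta> m = \<beta> m ** N" if "N ** A = A ** N" "N ** X = X ** N" for N m
    unfolding \<beta>_def using that
    by (intro ext_beta_commute) (simp_all add: matrix_add_ldistrib matrix_add_rdistrib)
  have decay: "\<exists>D\<ge>0. \<forall>m. norm (\<beta> m) \<le> D / real (Suc m) ^ N" for N
    unfolding \<beta>_def by (rule norm_ext_beta_le[OF assms(4), where A = A and Q = "mat c" and N = N]) blast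
  obtain T where T: "((\<lambda>(i, j). (z ^ i * w ^ j / (fact i * fact j)) *\<^sub>m
          (\<beta> (i + j) ** mpochhammer B i ** mpochhammer B' j)) has_sum T) UNIV"
    and series: "((\<lambda>n. (t ^ n / fact n) *\<^sub>m (mpochhammer B' n **
          (\<Sum>m. (z ^ m / fact m) *\<^sub>m (mpochhammer (B - mat (of_nat n)) m ** \<beta> m)))) has_sum (P ** T)) UNIV"
    using pochhammer_moment_identity[OF \<open>B ** B' = B' ** B\<close> comm comm decay \<open>norm z \<le> 1\<close> \<open>norm t < 1 / (1 + norm z)\<close>,
        OF assms(6)[symmetric] assms(8) assms(7)[symmetric] assms(9)]
    unfolding w_def P_def by blast
  have AT: "T ** A = A ** T"
  proof (rule has_sum_unique)
    let ?g = "\<lambda>(i, j). (z ^ i * w ^ j / (fact i * fact j)) *\<^sub>m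
      (\<beta> (i + j) ** mpochhammer B i ** mpochhammer B' j)"
    show "((\<lambda>p. A ** ?g p) has_sum A ** T) UNIV"
      by (rule has_sum_bounded_linear[OF bounded_linear_mul_right T])
    have "A ** ?g p = ?g p ** A" for p
    proof (cases p)
      case (Pair i j)
      have "A ** \<beta> (i + j) = \<beta> (i + j) ** A"
        by (rule comm) (simp_all add: assms)
      moreover have "A ** mpochhammer B i = mpochhammer B i ** A" "A ** mpochhammer B' j = mpochhammer B' j ** A"
        by (simp_all add: mpochhammer_commute assms)
      ultimately have "A ** (\<beta> (i + j) ** mpochhammer B i ** mpochhammer B' j)
          = \<beta> (i + j) ** mpochhammer B i ** mpochhammer B' j ** A"
        by (metis matrix_mul_assoc)
      then show ?thesis by (simp add: Pair)
    qed
    then show "((\<lambda>p. A ** ?g p) has_sum T ** A) UNIV"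
      using has_sum_bounded_linear[OF bounded_linear_mul_left T, of A] by simp
  qed
  define \<Gamma>\<^sub>R where "\<Gamma>\<^sub>R = mGamma (A + mat c)"
  define IA where "IA = matrix_inv (mGamma A)"
  define Ic where "Ic = matrix_inv (mGamma (mat c) :: 'r cmat)"
  have "Re c > 0"
    using assms by (simp add: c_def)
  have R: "T ** \<Gamma>\<^sub>R = \<Gamma>\<^sub>R ** T"
    unfolding \<Gamma>\<^sub>R_def by (rule mGamma_commute) (simp add: AT matrix_add_ldistrib matrix_add_rdistrib)
  have IA: "T ** IA = IA ** T"
    unfolding IA_def by (intro matrix_inv_commute invertible_mGamma mGamma_commute AT assms)
  have Ic: "T ** Ic = Ic ** T"
    unfolding Ic_def
    by (intro matrix_inv_commute invertible_mGamma mGamma_commute positive_stable_mat \<open>Re c > 0\<close>) simp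
  have "((\<lambda>n. (t ^ n / fact n) *\<^sub>m (mpochhammer B' n **
        (\<Sum>m. (z ^ m / fact m) *\<^sub>m (mpochhammer (B - mat (of_nat n)) m ** \<beta> m))) ** (\<Gamma>\<^sub>R ** IA ** Ic))
      has_sum (P ** T ** (\<Gamma>\<^sub>R ** IA ** Ic))) UNIV"
    by (rule has_sum_bounded_linear[OF bounded_linear_mul_left series])
  moreover have "P ** T ** (\<Gamma>\<^sub>R ** IA ** Ic) = P ** ext_appell1 A B B' (A + mat c) z w X"
  proof -
    have "ext_appell1 A B B' (A + mat c) z w X = \<Gamma>\<^sub>R ** IA ** Ic ** T"
      unfolding ext_appell1_def \<Gamma>\<^sub>R_def IA_def Ic_def using infsumI[OF T] by (simp add: \<beta>_def)
    moreover have "T ** (\<Gamma>\<^sub>R ** IA ** Ic) = \<Gamma>\<^sub>R ** IA ** Ic ** T"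
      by (metis R IA Ic matrix_mul_assoc)
    ultimately show ?thesis
      by (simp add: matrix_mul_assoc[symmetric])
  qed
  moreover have "(t ^ n / fact n) *\<^sub>m (mpochhammer B' n **
        (\<Sum>m. (z ^ m / fact m) *\<^sub>m (mpochhammer (B - mat (of_nat n)) m ** \<beta> m))) ** (\<Gamma>\<^sub>R ** IA ** Ic)
      = (t ^ n / fact n) *\<^sub>m (mpochhammer B' n ** ext_gauss X (B - mat (of_nat n)) A (A + mat c) z)" for n
    unfolding ext_gauss_def \<Gamma>\<^sub>R_def IA_def Ic_def by (simp add: \<beta>_def matrix_mul_assoc)
  ultimately show ?thesis
    unfolding c_def w_def P_def by (simp only: has_sum_imp_sums)
qed

end
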